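(* Let $A$ be a finite alphabet with $r=|A|\ge 2$ and let $F(A)$ be the free group with basis $A$. The probability for a subgroup chosen uniformly at random among the size $n$ subgroups of $F(A)$ to have finite index in $F(A)$ is $\mathcal{O}\left(n^{r/4}e^{-2r\sqrt n}\right)$. In particular, it is $o(n^{-k})$ for any $k\ge 1$.
   Context: An $A$-graph is a pair $\Gamma=(V,E)$ with $V$ finite and $E\subseteq V\times A\times V$ such that $(u,a,v),(u,a,v')\in E$ implies $v=v'$, and $(u,a,v),(u',a,v)\in E$ implies $u=u'$. It is connected if its underlying undirected graph is connected. A vertex is a leaf if it occurs at most once in the list of triples defining $E$ (a loop $(v,a,v)$ counts as two occurrences of $v$). Given a vertex $v$, $\Gamma$ is $v$-trim if no vertex $w\neq v$ is a leaf, and the pair $(\Gamma,v)$ is admissible if $\Gamma$ is connected and $v$-trim. By Stallings foldings, each finitely generated subgroup $H\le F(A)$ is represented by an admissible pair $(\Gamma,1)$ (with $1$ a designated vertex), unique up to isomorphism, called the graphical representation of $H$; $H$ is the set of reduced words over $A\sqcup A^{-1}$ labeling closed paths at the vertex $1$ (edges may be traversed backwards, reading the inverse letter). Conversely every admissible pair is the graphical representation of a unique finitely generated subgroup. The size of $H$ is the number of vertices of $\Gamma$; there are finitely many subgroups of each size. $H$ has finite index if and only if for each vertex $v$ of $\Gamma$ and each $a\in A$ there is an edge of the form $(v,a,w)$ in $\Gamma$. *)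

theory Defs
  imports
    "HOL-Algebra.Generated_Groups"
    "HOL-Library.Landau_Symbols"
    "HOL-Probability.Probability_Mass_Function"
begin

section \<open>The free group on an alphabet\<close>

text \<open>The letter (a, True) stands for a, and (a, False) for its formal inverse.\<close>

type_synonym 'a letter = "'a \<times> bool"

definition inv_letter :: "'a letter \<Rightarrow> 'a letter" where
  "inv_letter x = (fst x, \<not> snd x)"

definition reduced :: "'a letter list \<Rightarrow> bool" where
  "reduced = successively (\<lambda>x y. y \<noteq> inv_letter x)"

fun push :: "'a letter \<Rightarrow> 'a letter list \<Rightarrow> 'a letter list" where
  "push x [] = [x]"
| "push x (y # ys) = (if y = inv_letter x then ys else x # y # ys)"

definition reduce :: "'a letter list \<Rightarrow> 'a letter list" where
  "reduce w = foldr push w []"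

definition free_group :: "'a set \<Rightarrow> 'a letter list monoid" where
  "free_group A =
    \<lparr>carrier = {w. reduced w \<and> set w \<subseteq> A \<times> UNIV},
     monoid.mult = (\<lambda>u w. reduce (u @ w)),
     one = []\<rparr>"

lemma inv_letter_invol [simp]: "inv_letter (inv_letter x) = x"
  by (simp add: inv_letter_def)

lemma reduced_Nil [simp]: "reduced []"
  by (simp add: reduced_def)

lemma reduced_Cons:
  "reduced (x # w) \<longleftrightarrow> reduced w \<and> (w = [] \<or> hd w \<noteq> inv_letter x)"
  by (auto simp: reduced_def successively_Cons)

lemma reduced_push: "reduced w \<Longrightarrow> reduced (push x w)"
  by (cases w) (auto simp: reduced_Cons)

lemma reduced_foldr_push: "reduced v \<Longrightarrow> reduced (foldr push u v)"
  by (induction u) (auto intro: reduced_push)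

lemma reduced_reduce [simp]: "reduced (reduce w)"
  by (simp add: reduce_def reduced_foldr_push)

lemma reduce_reduced: "reduced w \<Longrightarrow> reduce w = w"
  unfolding reduce_def
proof (induction w)
  case (Cons x w)
  then show ?case by (cases w) (auto simp: reduced_Cons)
qed simp

lemma push_inv_push: "reduced w \<Longrightarrow> push x (push (inv_letter x) w) = w"
proof (cases w)
  case (Cons y ys)
  assume "reduced w"
  then show ?thesis by (cases ys) (auto simp: Cons reduced_Cons)
qed simp

lemma foldr_push_push:
  assumes "reduced v"
  shows "foldr push (push x u) v = push x (foldr push u v)"
proof (cases u)
  case (Cons y ys)
  then show ?thesis
    using push_inv_push[OF reduced_foldr_push[OF assms], of x ys] by auto
qed simp

lemma foldr_push_reduce: "reduced v \<Longrightarrow> foldr push (reduce u) v = foldr push u v"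
  unfolding reduce_def by (induction u) (simp_all add: foldr_push_push)

lemma reduce_append: "reduce (u @ w) = foldr push u (reduce w)"
  by (simp add: reduce_def)

lemma reduce_reduce_left: "reduce (reduce u @ w) = reduce (u @ w)"
  by (simp add: reduce_append foldr_push_reduce)

lemma reduce_reduce_right: "reduce (u @ reduce w) = reduce (u @ w)"
  by (simp add: reduce_append reduce_reduced)

lemma set_push: "set (push x w) \<subseteq> insert x (set w)"
  by (cases w) auto

lemma set_reduce: "set (reduce w) \<subseteq> set w"
  unfolding reduce_def by (induction w) (use set_push in fastforce)+

lemma reduce_inverse: "reduce (rev (map inv_letter w) @ w) = []"
proof (induction w)
  case (Cons x w)
  have "push (inv_letter x) (push x (foldr push w [])) = foldr push w []"
    using push_inv_push[of "foldr push w []" "inv_letter x"] by (simp add: reduced_foldr_push)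
  then show ?case
    using Cons by (simp add: reduce_def)
qed (simp add: reduce_def)

lemma group_free_group: "group (free_group A)"
proof (rule groupI)
  show "u \<otimes>\<^bsub>free_group A\<^esub> v \<otimes>\<^bsub>free_group A\<^esub> w =
      u \<otimes>\<^bsub>free_group A\<^esub> (v \<otimes>\<^bsub>free_group A\<^esub> w)" for u v w
    by (simp add: free_group_def reduce_reduce_left reduce_reduce_right)
next
  fix w
  assume w: "w \<in> carrier (free_group A)"
  let ?w = "reduce (rev (map inv_letter w))"
  have "set ?w \<subseteq> A \<times> UNIV"
    using w set_reduce[of "rev (map inv_letter w)"]
    by (fastforce simp: free_group_def inv_letter_def)
  moreover have "reduce (?w @ w) = []"
    by (simp add: reduce_reduce_left reduce_inverse)
  ultimately show "\<exists>v\<in>carrier (free_group A). v \<otimes>\<^bsub>free_group A\<^esub> w = \<one>\<^bsub>free_group A\<^esub>"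
    by (intro bexI[of _ ?w]) (simp_all add: free_group_def)
qed (use set_reduce in \<open>fastforce simp: free_group_def reduce_reduced\<close>)+

definition fin_gen_subgroup :: "('g, 'b) monoid_scheme \<Rightarrow> 'g set \<Rightarrow> bool" where
  "fin_gen_subgroup G H \<longleftrightarrow>
    subgroup H G \<and> (\<exists>S. finite S \<and> S \<subseteq> carrier G \<and> H = generate G S)"

definition finite_index :: "('g, 'b) monoid_scheme \<Rightarrow> 'g set \<Rightarrow> bool" where
  "finite_index G H \<longleftrightarrow> finite (rcosets\<^bsub>G\<^esub> H)"


section \<open>Graphs with edges labelled by an alphabet\<close>

type_synonym ('v, 'a) lgraph = "'v set \<times> ('v \<times> 'a \<times> 'v) set"

definition A_graph :: "'a set \<Rightarrow> ('v, 'a) lgraph \<Rightarrow> bool" where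
  "A_graph A \<Gamma> \<longleftrightarrow> (case \<Gamma> of (V, E) \<Rightarrow>
     finite V \<and> E \<subseteq> V \<times> A \<times> V \<and>
     (\<forall>u a v v'. (u, a, v) \<in> E \<and> (u, a, v') \<in> E \<longrightarrow> v = v') \<and>
     (\<forall>u u' a v. (u, a, v) \<in> E \<and> (u', a, v) \<in> E \<longrightarrow> u = u'))"

definition adjacency :: "('v \<times> 'a \<times> 'v) set \<Rightarrow> ('v \<times> 'v) set" where
  "adjacency E = {(u, v). \<exists>a. (u, a, v) \<in> E \<or> (v, a, u) \<in> E}"

definition graph_connected :: "('v, 'a) lgraph \<Rightarrow> bool" where
  "graph_connected \<Gamma> \<longleftrightarrow> (case \<Gamma> of (V, E) \<Rightarrow> \<forall>u\<in>V. \<forall>v\<in>V. (u, v) \<in> (adjacency E)\<^sup>*)"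

definition occurrences :: "('v \<times> 'a \<times> 'v) set \<Rightarrow> 'v \<Rightarrow> nat" where
  "occurrences E v = card {e \<in> E. fst e = v} + card {e \<in> E. snd (snd e) = v}"

definition leaf :: "('v, 'a) lgraph \<Rightarrow> 'v \<Rightarrow> bool" where
  "leaf \<Gamma> v \<longleftrightarrow> v \<in> fst \<Gamma> \<and> occurrences (snd \<Gamma>) v \<le> 1"

definition trim :: "('v, 'a) lgraph \<Rightarrow> 'v \<Rightarrow> bool" where
  "trim \<Gamma> v \<longleftrightarrow> (\<forall>w\<in>fst \<Gamma>. w \<noteq> v \<longrightarrow> \<not> leaf \<Gamma> w)"

definition admissible :: "'a set \<Rightarrow> ('v, 'a) lgraph \<Rightarrow> 'v \<Rightarrow> bool" where
  "admissible A \<Gamma> v \<longleftrightarrow>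
    A_graph A \<Gamma> \<and> v \<in> fst \<Gamma> \<and> graph_connected \<Gamma> \<and> trim \<Gamma> v"

fun is_path :: "('v \<times> 'a \<times> 'v) set \<Rightarrow> 'v \<Rightarrow> 'a letter list \<Rightarrow> 'v \<Rightarrow> bool" where
  "is_path E u [] w \<longleftrightarrow> u = w"
| "is_path E u ((a, s) # xs) w \<longleftrightarrow>
    (\<exists>v. (if s then (u, a, v) \<in> E else (v, a, u) \<in> E) \<and> is_path E v xs w)"

definition graphical_representation ::
    "'a set \<Rightarrow> ('v, 'a) lgraph \<Rightarrow> 'v \<Rightarrow> 'a letter list set \<Rightarrow> bool" where
  "graphical_representation A \<Gamma> v H \<longleftrightarrow>
    admissible A \<Gamma> v \<and> H = {w. reduced w \<and> is_path (snd \<Gamma>) v w v}"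


section \<open>Random subgroups of a given size\<close>

text \<open>The size is given as a relation rather than a function, so that it makes sense without
  the uniqueness of graphical representations. Since graphs are finite, it is no restriction
  to take natural numbers as vertices.\<close>

definition has_size :: "'a set \<Rightarrow> 'a letter list set \<Rightarrow> nat \<Rightarrow> bool" where
  "has_size A H n \<longleftrightarrow>
    (\<exists>(\<Gamma> :: (nat, 'a) lgraph) v. graphical_representation A \<Gamma> v H \<and> card (fst \<Gamma>) = n)"

definition subgroups_of_size :: "'a set \<Rightarrow> nat \<Rightarrow> 'a letter list set set" where
  "subgroups_of_size A n = {H. fin_gen_subgroup (free_group A) H \<and> has_size A H n}"

text \<open>For finite A and positive n, the set of subgroups of size n is finite and nonempty,
  so that the uniform distribution is meaningful; the value at n = 0 is irrelevant.\<close>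

definition prob_finite_index :: "'a set \<Rightarrow> nat \<Rightarrow> real" where
  "prob_finite_index A n =
    measure_pmf.prob (pmf_of_set (subgroups_of_size A n)) {H. finite_index (free_group A) H}"

end

theory Submission imports Defs "HOL-Real_Asymp.Real_Asymp" begin

text \<open>
  A subgroup of size n is an isomorphism class of admissible graphs with n vertices. Such a graph is rigid once its
  base point is fixed, as every vertex is reached from there by a path, so every class consists of exactly
  (n - 1)! graphs on the vertex set {..<n} with base point 0 (\<open>card_fibre\<close>), and subgroups may be
  replaced by labelled graphs (\<open>prob_finite_index_eq\<close>). The point is that two admissible
  graphs with the same reduced closed paths are isomorphic (\<open>graphical_representation_unique\<close>): by
  trimness each edge lies on a reduced closed path at the base point
  (\<open>geodesic_extends_to_loop\<close>), so either graph can be read off the paths of the other.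

  An edge set whose edges satisfy both determinism conditions is a choice of one partial injection of the
  vertices for each of the r letters. If the subgroup has finite index, all of these are permutations
  (\<open>complete_if_finite_index\<close>), which leaves at most (n!)^r graphs. On the other hand
  almost all r-tuples of partial injections are admissible, and half of them suffice here
  (\<open>eventually_half_admissible\<close>).
  A random partial injection misses a given point in its domain with probability at most
  1 / sqrt n and misses it on both sides with probability at most 1 / n, so that
  leaves occur with probability O(n^(3/2 - r)). A splitting into blocks of k and n - k points
  costs a factor (n choose k)^(r - 1), and summing over k \<le> n / 2 shows that the graph is
  disconnected with probability O(1 / n).

  Hence the probability in question is at most 2 (n! / I)^r, where I is the number of partial injections
  of n points. As I / n! is the sum of (n choose j) / j!, the
  squares of the Poisson weights of parameter sqrt n bound it from below by a constant
  times n^(-1/4) e^(2 sqrt n) (\<open>pinj_ratio_ge\<close>), which is the claim.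
\<close>

section \<open>Paths in folded graphs\<close>

definition folded :: "('v \<times> 'a \<times> 'v) set \<Rightarrow> bool" where
  "folded E \<longleftrightarrow>
    (\<forall>u a v v'. (u, a, v) \<in> E \<and> (u, a, v') \<in> E \<longrightarrow> v = v') \<and>
    (\<forall>u u' a v. (u, a, v) \<in> E \<and> (u', a, v) \<in> E \<longrightarrow> u = u')"

definition step :: "('v \<times> 'a \<times> 'v) set \<Rightarrow> 'v \<Rightarrow> 'a letter \<Rightarrow> 'v \<Rightarrow> bool" where
  "step E u x v \<longleftrightarrow> (if snd x then (u, fst x, v) \<in> E else (v, fst x, u) \<in> E)"

definition inv_word :: "'a letter list \<Rightarrow> 'a letter list" where
  "inv_word w = rev (map inv_letter w)"

lemma step_inv_letter [simp]: "step E v (inv_letter x) u \<longleftrightarrow> step E u x v"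
  by (auto simp: step_def inv_letter_def)

lemma is_path_Cons [simp]:
  "is_path E u (x # xs) w \<longleftrightarrow> (\<exists>v. step E u x v \<and> is_path E v xs w)"
  by (cases x) (auto simp: step_def)

declare is_path.simps(2) [simp del]

lemma is_path_append:
  "is_path E u (xs @ ys) w \<longleftrightarrow> (\<exists>v. is_path E u xs v \<and> is_path E v ys w)"
  by (induction xs arbitrary: u) auto

lemma is_path_snoc:
  "is_path E u (xs @ [x]) w \<longleftrightarrow> (\<exists>v. is_path E u xs v \<and> step E v x w)"
  by (simp add: is_path_append)

lemma is_path_inv_word [simp]: "is_path E v (inv_word w) u \<longleftrightarrow> is_path E u w v"
  by (induction w arbitrary: u) (auto simp: inv_word_def is_path_append)

lemma inv_word_append [simp]: "inv_word (u @ v) = inv_word v @ inv_word u"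
  by (simp add: inv_word_def)

lemma inv_word_inv_word [simp]: "inv_word (inv_word w) = w"
  by (simp add: inv_word_def rev_map o_def)

lemma inv_word_simps [simp]: "inv_word [] = []" "inv_word (x # w) = inv_word w @ [inv_letter x]"
  by (simp_all add: inv_word_def)

lemma inv_word_Nil_iff [simp]: "inv_word w = [] \<longleftrightarrow> w = []"
  by (simp add: inv_word_def)

lemma hd_inv_word: "w \<noteq> [] \<Longrightarrow> hd (inv_word w) = inv_letter (last w)"
  by (simp add: inv_word_def hd_rev last_map)

lemma set_inv_word: "set w \<subseteq> A \<times> UNIV \<Longrightarrow> set (inv_word w) \<subseteq> A \<times> UNIV"
  by (auto simp: inv_word_def inv_letter_def)

lemma length_reduce: "length (reduce w) \<le> length w"
proof (induction w)
  case (Cons x w)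
  have "length (push x v) \<le> Suc (length v)" for v by (cases v) auto
  from this[of "reduce w"] Cons show ?case by (simp add: reduce_def)
qed (simp add: reduce_def)

lemma inv_letter_eq_iff: "inv_letter x = y \<longleftrightarrow> x = inv_letter y"
  by auto

lemma reduced_append:
  "reduced (u @ v) \<longleftrightarrow>
    reduced u \<and> reduced v \<and> (u = [] \<or> v = [] \<or> hd v \<noteq> inv_letter (last u))"
  by (auto simp: reduced_def successively_append_iff)

lemma reduced_singleton [simp]: "reduced [x]"
  by (simp add: reduced_def)

lemma reduced_inv_word [simp]: "reduced (inv_word w) \<longleftrightarrow> reduced w"
proof (induction w)
  case (Cons x w)
  then show ?case
    by (cases w) (auto simp: reduced_append reduced_Cons inv_letter_eq_iff)
qed simp

lemma foldedD:
  assumes "folded E"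
  shows "(u, a, v) \<in> E \<Longrightarrow> (u, a, v') \<in> E \<Longrightarrow> v = v'"
    and "(u, a, v) \<in> E \<Longrightarrow> (u', a, v) \<in> E \<Longrightarrow> u = u'"
  using assms unfolding folded_def by metis+

lemma step_det:
  assumes "folded E" "step E u x v" "step E u x v'"
  shows "v = v'"
  using assms(2,3) foldedD[OF assms(1)] unfolding step_def by (metis (full_types))

lemma is_path_det:
  assumes "folded E" "is_path E u w v" "is_path E u w v'"
  shows "v = v'"
  using assms(2,3) by (induction w arbitrary: u) (auto dest: step_det[OF assms(1)])

text \<open>Inverse letters are read backwards, and a folded graph is deterministic in both directions, so a letter
  followed by its inverse leads back to where it started: paths survive free reduction.\<close>

lemma is_path_push:
  assumes "folded E" "step E u x v" "is_path E v w t"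
  shows "is_path E u (push x w) t"
proof (cases w)
  case Nil
  then show ?thesis using assms by simp
next
  case (Cons y ys)
  show ?thesis
  proof (cases "y = inv_letter x")
    case True
    with assms Cons obtain s where "step E v y s" "is_path E s ys t" by auto
    moreover have "s = u"
      using step_det[OF assms(1), of v y s u] \<open>step E v y s\<close> assms(2) True by simp
    ultimately show ?thesis using Cons True by simp
  next
    case False
    then show ?thesis using assms Cons by auto
  qed
qed

lemma is_path_reduce:
  assumes "folded E" "is_path E u w v"
  shows "is_path E u (reduce w) v"
  using assms(2)
proof (induction w arbitrary: u)
  case (Cons x w)
  then show ?case
    by (auto simp: reduce_def intro: is_path_push[OF assms(1)])
qed (simp add: reduce_def)

lemma reduce_inv_word [simp]: "reduce (inv_word w @ w) = []" "reduce (w @ inv_word w) = []"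
  using reduce_inverse[of w] reduce_inverse[of "inv_word w"]
  by (simp_all add: inv_word_def[symmetric])

lemma reduce_cancel: "reduce (u @ inv_word w @ w @ v) = reduce (u @ v)"
proof -
  have "reduce ((inv_word w @ w) @ v) = reduce v"
    using reduce_reduce_left[of "inv_word w @ w" v] by (simp del: append_assoc)
  then show ?thesis
    by (metis append_assoc reduce_reduce_right)
qed

lemma is_path_set:
  assumes "E \<subseteq> V \<times> A \<times> V" "is_path E u w v"
  shows "set w \<subseteq> A \<times> UNIV" "u \<in> V \<Longrightarrow> v \<in> V"
  using assms(2)
  by (induction w arbitrary: u) (use assms(1) in \<open>fastforce simp: step_def split: if_splits\<close>)+

lemma is_path_if_connected:
  assumes "(u, v) \<in> (adjacency E)\<^sup>*"
  shows "\<exists>w. is_path E u w v"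
  using assms
proof (induction rule: rtrancl_induct)
  case base
  show ?case by (rule exI[of _ "[]"]) simp
next
  case (step y z)
  then obtain w a where "is_path E u w y" "(y, a, z) \<in> E \<or> (z, a, y) \<in> E"
    by (auto simp: adjacency_def)
  then show ?case
    by (intro exI[of _ "w @ [(a, (y, a, z) \<in> E)]"]) (auto simp: is_path_append step_def)
qed

lemma is_path_adjacency: "is_path E u w v \<Longrightarrow> (u, v) \<in> (adjacency E)\<^sup>*"
proof (induction w arbitrary: u)
  case (Cons x w)
  then obtain t where "step E u x t" "(t, v) \<in> (adjacency E)\<^sup>*" by auto
  moreover from this have "(u, t) \<in> adjacency E"
    by (auto simp: step_def adjacency_def split: if_splits)
  ultimately show ?case by (meson converse_rtrancl_into_rtrancl)
qed simp

section \<open>The subgroup read off a graph\<close>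

definition loops :: "('v \<times> 'a \<times> 'v) set \<Rightarrow> 'v \<Rightarrow> 'a letter list set" where
  "loops E v = {w. reduced w \<and> is_path E v w v}"

lemma loops_path: "w \<in> loops E v \<Longrightarrow> is_path E v w v"
  by (simp add: loops_def)

lemma carrier_free_group: "carrier (free_group A) = {w. reduced w \<and> set w \<subseteq> A \<times> UNIV}"
  and mult_free_group: "u \<otimes>\<^bsub>free_group A\<^esub> w = reduce (u @ w)"
  and one_free_group: "\<one>\<^bsub>free_group A\<^esub> = []"
  by (simp_all add: free_group_def)

lemma inv_free_group:
  assumes "w \<in> carrier (free_group A)"
  shows "inv\<^bsub>free_group A\<^esub> w = inv_word w"
proof -
  interpret group "free_group A" by (rule group_free_group)
  show ?thesis
    by (rule inv_equality)
      (use assms set_inv_word[of w] in \<open>auto simp: carrier_free_group mult_free_group one_free_group\<close>)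
qed

lemma subgroup_loops:
  assumes "folded E" "E \<subseteq> V \<times> A \<times> V"
  shows "subgroup (loops E v) (free_group A)"
proof -
  interpret group "free_group A" by (rule group_free_group)
  have sub: "loops E v \<subseteq> carrier (free_group A)"
    using is_path_set(1)[OF assms(2)] by (auto simp: loops_def carrier_free_group)
  show ?thesis
  proof (rule subgroupI)
    show "loops E v \<noteq> {}"
      by (auto simp: loops_def intro!: exI[of _ "[]"])
    show "inv\<^bsub>free_group A\<^esub> w \<in> loops E v" if "w \<in> loops E v" for w
      using that sub by (subst inv_free_group) (auto simp: loops_def)
    show "u \<otimes>\<^bsub>free_group A\<^esub> w \<in> loops E v" if "u \<in> loops E v" "w \<in> loops E v" for u w
      using that by (auto simp: loops_def mult_free_group is_path_append
          intro!: is_path_reduce[OF assms(1)])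
  qed (fact sub)
qed

text \<open>Generators come from a choice of a path from the base point to each vertex: an edge, prolonged
  on both sides by the chosen paths, gives a closed path, and every closed path is a product of these.\<close>

lemma fin_gen_loops:
  assumes fold: "folded E" and EV: "E \<subseteq> V \<times> A \<times> V" and fin: "finite E"
    and conn: "\<And>u. u \<in> V \<Longrightarrow> (v, u) \<in> (adjacency E)\<^sup>*" and v: "v \<in> V"
  shows "fin_gen_subgroup (free_group A) (loops E v)"
proof -
  interpret group "free_group A" by (rule group_free_group)
  have "\<forall>u\<in>V. \<exists>w. is_path E v w u" using is_path_if_connected[OF conn] by blast
  then obtain p0 where p0: "\<And>u. u \<in> V \<Longrightarrow> is_path E v (p0 u) u" by metis
  \<comment> \<open>With the empty path chosen at the base point, products of generators telescope exactly.\<close>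
  define p where "p = p0(v := [])"
  have p: "is_path E v (p u) u" if "u \<in> V" for u
    using p0[OF that] by (auto simp: p_def)
  define g where "g = (\<lambda>(u, a, t). reduce (p u @ (a, True) # inv_word (p t)))"
  define S where "S = g ` E"
  have S_loops: "S \<subseteq> loops E v"
  proof
    fix s assume "s \<in> S"
    then obtain u a t where e: "(u, a, t) \<in> E" and s: "s = g (u, a, t)" by (auto simp: S_def)
    then have "u \<in> V" "t \<in> V" using EV by auto
    moreover have "step E u (a, True) t" using e by (simp add: step_def)
    ultimately have "is_path E v (p u @ (a, True) # inv_word (p t)) v"
      using p[of u] p[of t] by (auto simp: is_path_append)
    then show "s \<in> loops E v"
      by (simp add: s g_def loops_def is_path_reduce[OF fold])
  qed
  have sg: "subgroup (loops E v) (free_group A)" by (rule subgroup_loops[OF fold EV])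
  then have S_car: "S \<subseteq> carrier (free_group A)" using S_loops subgroup.subset by blast
  have gen_sg: "subgroup (generate (free_group A) S) (free_group A)"
    by (rule generate_is_subgroup[OF S_car])
  have gen_step: "reduce (p u @ x # inv_word (p t)) \<in> generate (free_group A) S"
    if x: "step E u x t" for u x t
  proof (cases "snd x")
    case True
    then have "(u, fst x, t) \<in> E" "x = (fst x, True)"
      using x by (simp_all add: step_def prod_eq_iff)
    then have "reduce (p u @ x # inv_word (p t)) \<in> S"
      by (metis (no_types, lifting) S_def case_prod_conv g_def image_eqI)
    then show ?thesis by (rule generate.incl)
  next
    case False
    have e: "(t, fst x, u) \<in> E" "inv_letter x = (fst x, True)"
      using x False by (simp_all add: step_def inv_letter_def)
    let ?q = "p t @ inv_letter x # inv_word (p u)"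
    have q: "reduce ?q \<in> S"
      using e by (metis (no_types, lifting) S_def case_prod_conv g_def image_eqI)
    have "inv\<^bsub>free_group A\<^esub> (reduce ?q) = reduce (p u @ x # inv_word (p t))"
    proof (rule inv_equality)
      show "reduce ?q \<in> carrier (free_group A)" using q S_car by auto
      have V: "u \<in> V" "t \<in> V" using EV e(1) by auto
      have "is_path E v (p u @ x # inv_word (p t)) v"
        using p[OF V(1)] p[OF V(2)] x by (auto simp: is_path_append)
      then show "reduce (p u @ x # inv_word (p t)) \<in> carrier (free_group A)"
        using is_path_set(1)[OF EV is_path_reduce[OF fold]] by (auto simp: carrier_free_group)
      have "reduce ((p u @ x # inv_word (p t)) @ ?q) = reduce ((p u @ [x]) @ inv_word (p u @ [x]))"
        using reduce_cancel[of "p u @ [x]" "p t"] by simp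
      then show "reduce (p u @ x # inv_word (p t)) \<otimes>\<^bsub>free_group A\<^esub> reduce ?q = \<one>\<^bsub>free_group A\<^esub>"
        by (simp only: mult_free_group one_free_group reduce_reduce_left reduce_reduce_right
            reduce_inv_word)
    qed
    then show ?thesis using generate.inv[OF q, of "free_group A"] by simp
  qed
  have gen_path: "reduce (p u @ w) \<in> generate (free_group A) S" if "is_path E u w v" for u w
    using that
  proof (induction w arbitrary: u)
    case Nil
    then show ?case using generate.one[of "free_group A" S]
      by (simp add: p_def one_free_group reduce_reduced)
  next
    case (Cons x w)
    then obtain t where t: "step E u x t" "is_path E t w v" by auto
    have "reduce (p u @ x # w) = reduce ((p u @ x # inv_word (p t)) @ (p t @ w))"
      using reduce_cancel[of "p u @ [x]" "p t" w] by simp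
    also have "\<dots> = reduce (p u @ x # inv_word (p t)) \<otimes>\<^bsub>free_group A\<^esub> reduce (p t @ w)"
      by (simp only: mult_free_group reduce_reduce_left reduce_reduce_right)
    also have "\<dots> \<in> generate (free_group A) S"
      using subgroup.m_closed[OF gen_sg gen_step[OF t(1)] Cons.IH[OF t(2)]] .
    finally show ?case .
  qed
  have "loops E v = generate (free_group A) S"
  proof
    show "generate (free_group A) S \<subseteq> loops E v"
      by (rule generate_subgroup_incl[OF S_loops sg])
    show "loops E v \<subseteq> generate (free_group A) S"
    proof
      fix w assume "w \<in> loops E v"
      then show "w \<in> generate (free_group A) S"
        using gen_path[of v w] by (simp add: loops_def p_def reduce_reduced)
    qed
  qed
  moreover have "finite S" using fin by (simp add: S_def)
  ultimately show ?thesis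
    using sg S_car by (auto simp: fin_gen_subgroup_def)
qed

section \<open>Geodesics and reduced closed paths\<close>

definition letters_at :: "('v \<times> 'a \<times> 'v) set \<Rightarrow> 'v \<Rightarrow> 'a letter set" where
  "letters_at E v = {x. \<exists>t. step E v x t}"

lemma letters_at_eq:
  "letters_at E v = (\<lambda>e. (fst (snd e), True)) ` {e \<in> E. fst e = v} \<union>
     (\<lambda>e. (fst (snd e), False)) ` {e \<in> E. snd (snd e) = v}"
proof -
  have "x \<in> letters_at E v \<longleftrightarrow>
      x \<in> (\<lambda>e. (fst (snd e), True)) ` {e \<in> E. fst e = v} \<union>
        (\<lambda>e. (fst (snd e), False)) ` {e \<in> E. snd (snd e) = v}" for x
    by (cases x; cases "snd x") (force simp: letters_at_def step_def image_iff)+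
  then show ?thesis by blast
qed

lemma occurrences_eq_card_letters:
  assumes "folded E" "finite E"
  shows "occurrences E v = card (letters_at E v)"
proof -
  have "card ((\<lambda>e. (fst (snd e), True)) ` {e \<in> E. fst e = v}) = card {e \<in> E. fst e = v}"
    by (intro card_image) (auto simp: inj_on_def dest: foldedD(1)[OF assms(1)])
  moreover have "card ((\<lambda>e. (fst (snd e), False)) ` {e \<in> E. snd (snd e) = v}) =
      card {e \<in> E. snd (snd e) = v}"
    by (intro card_image) (auto simp: inj_on_def dest: foldedD(2)[OF assms(1)])
  ultimately show ?thesis
    using assms(2) unfolding occurrences_def letters_at_eq
    by (subst card_Un_disjoint) auto
qed

lemma finite_letters_at: "finite E \<Longrightarrow> finite (letters_at E v)"
  by (simp add: letters_at_eq)

locale pointed_graph =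
  fixes A :: "'a set" and V :: "'v set" and E :: "('v \<times> 'a \<times> 'v) set" and b :: 'v
  assumes admissible: "admissible A (V, E) b"
    and finite_alphabet: "finite A"
begin

lemma edges: "E \<subseteq> V \<times> A \<times> V" and fold: "folded E" and finite_V: "finite V" and base: "b \<in> V"
  using admissible by (auto simp: admissible_def A_graph_def folded_def)

lemma finite_E: "finite E"
  using edges finite_V finite_alphabet by (meson finite_SigmaI finite_subset)

lemma step_V: "step E u x v \<Longrightarrow> u \<in> V" "step E u x v \<Longrightarrow> v \<in> V"
  using edges by (auto simp: step_def split: if_splits)

lemma connected: "u \<in> V \<Longrightarrow> v \<in> V \<Longrightarrow> (u, v) \<in> (adjacency E)\<^sup>*"
  using admissible by (auto simp: admissible_def graph_connected_def)

lemma other_letter: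
  assumes "v \<in> V" "v \<noteq> b"
  obtains x t where "x \<noteq> l" "step E v x t"
proof -
  have "\<not> card (letters_at E v) \<le> 1"
    using admissible assms occurrences_eq_card_letters[OF fold finite_E]
    by (auto simp: admissible_def trim_def leaf_def)
  then have "\<not> letters_at E v \<subseteq> {l}"
    using card_mono[of "{l}" "letters_at E v"] by auto
  then show ?thesis using that by (auto simp: letters_at_def)
qed

definition path_dist :: "'v \<Rightarrow> nat" where
  "path_dist u = (LEAST n. \<exists>w. is_path E b w u \<and> length w = n)"

definition geodesic :: "'a letter list \<Rightarrow> 'v \<Rightarrow> bool" where
  "geodesic w u \<longleftrightarrow> reduced w \<and> is_path E b w u \<and> length w = path_dist u"

lemma path_dist_le: "is_path E b w u \<Longrightarrow> path_dist u \<le> length w"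
  unfolding path_dist_def by (rule Least_le) blast

lemma ex_geodesic:
  assumes "u \<in> V"
  obtains w where "geodesic w u"
proof -
  obtain w0 where "is_path E b w0 u"
    using is_path_if_connected[OF connected[OF base assms]] by blast
  then have "\<exists>n w. is_path E b w u \<and> length w = n" by blast
  then have "\<exists>w. is_path E b w u \<and> length w = path_dist u"
    unfolding path_dist_def by (rule LeastI_ex)
  then obtain w where w: "is_path E b w u" "length w = path_dist u" by blast
  have "is_path E b (reduce w) u" by (rule is_path_reduce[OF fold w(1)])
  then have "geodesic (reduce w) u"
    using path_dist_le[of "reduce w" u] length_reduce[of w] w(2) by (simp add: geodesic_def)
  then show ?thesis by (rule that)
qed

text \<open>At the far end of a geodesic prolonged by one letter there are two possibilities. Either
  the prolonged path is still geodesic; its end is then neither the base point nor a leaf,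
  so it can be prolonged further, and distances are bounded. Or it is not, and then
  returning along a geodesic of the end point creates no cancellation, as that would give a shortcut
  for the original path.\<close>

lemma geodesic_extends_to_loop:
  assumes "geodesic p u" "reduced (p @ [m])" "step E u m z"
  shows "\<exists>q. p @ [m] @ q \<in> loops E b"
  using assms
  \<comment> \<open>The sum of all distances serves as an upper bound for each of them.\<close>
proof (induction "sum path_dist V - length p" arbitrary: p u m z rule: less_induct)
  case less
  have path: "is_path E b (p @ [m]) z"
    using less.prems by (auto simp: geodesic_def is_path_append)
  have z: "z \<in> V" using step_V less.prems(3) by blast
  obtain q where q: "geodesic q z" by (rule ex_geodesic[OF z])
  show ?case
  proof (cases "path_dist z = length p + 1")
    case True
    then have geo: "geodesic (p @ [m]) z" using path less.prems by (simp add: geodesic_def)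
    have "path_dist b = 0" using path_dist_le[of "[]" b] by simp
    then have "z \<noteq> b" using True by auto
    then obtain x t where x: "x \<noteq> inv_letter m" "step E z x t" using other_letter[OF z] by metis
    have "path_dist z \<le> sum path_dist V" using member_le_sum[OF z, of path_dist] finite_V by simp
    then have "sum path_dist V - length (p @ [m]) < sum path_dist V - length p"
      using True by simp
    then have "\<exists>q. (p @ [m]) @ [x] @ q \<in> loops E b"
      by (rule less.hyps[OF _ geo _ x(2)]) (use x less.prems(2) in \<open>auto simp: reduced_append reduced_Cons\<close>)
    then show ?thesis by auto
  next
    case False
    then have short: "path_dist z \<le> length p" using path_dist_le[OF path] by simp
    have "last q \<noteq> m" if "q \<noteq> []"
    proof
      assume "last q = m"
      then have q': "q = butlast q @ [m]" using that by (metis append_butlast_last_id)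
      then obtain y where y: "is_path E b (butlast q) y" "step E y m z"
        using q unfolding geodesic_def by (metis is_path_snoc)
      then have "y = u"
        using step_det[OF fold, of z "inv_letter m" y u] less.prems(3) by simp
      then have "path_dist u \<le> length (butlast q)" using path_dist_le y by blast
      then show False
        using short q less.prems(1) that length_butlast[of q] length_greater_0_conv[of q]
        unfolding geodesic_def by linarith
    qed
    then have "reduced ((p @ [m]) @ inv_word q)"
      using less.prems(2) q
      by (auto simp: geodesic_def reduced_append hd_inv_word inv_letter_eq_iff reduced_Cons)
    moreover have "is_path E b ((p @ [m]) @ inv_word q) b"
      using path q by (auto simp: is_path_append geodesic_def)
    ultimately show ?thesis by (auto simp: loops_def)
  qed
qed

text \<open>Every edge of an admissible graph therefore lies on a reduced closed path at the base point: it either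
  prolongs a geodesic to its start without cancellation, or is the last edge of that geodesic. Hence it is seen
  by every graph that can read these closed paths.\<close>

lemma step_transfer:
  assumes sub: "loops E b \<subseteq> loops E' b'" and st: "step E u m z"
  obtains w u' z' where "is_path E b w u" "is_path E' b' w u'" "step E' u' m z'"
proof -
  have u: "u \<in> V" and z: "z \<in> V" by (fact step_V[OF st])+
  obtain p where p: "geodesic p u" by (rule ex_geodesic[OF u])
  have path: "is_path E b p u" using p by (simp add: geodesic_def)
  show ?thesis
  proof (cases "reduced (p @ [m])")
    case True
    obtain q where "p @ [m] @ q \<in> loops E b"
      using geodesic_extends_to_loop[OF p True st] by blast
    then have "p @ [m] @ q \<in> loops E' b'" using sub by blast
    then obtain u' z' where "is_path E' b' p u'" "step E' u' m z'"
      using loops_path[of "p @ [m] @ q" E' b'] by (auto simp: is_path_append)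
    then show ?thesis by (rule that[OF path])
  next
    case False
    then have "p \<noteq> []" "last p = inv_letter m"
      using p by (auto simp: geodesic_def reduced_append)
    then obtain p' where p': "p = p' @ [inv_letter m]" by (metis append_butlast_last_id)
    then obtain y where y: "is_path E b p' y" "step E y (inv_letter m) u"
      using path by (metis is_path_snoc)
    then have yz: "y = z" using step_det[OF fold, of u m y z] st by simp
    have "path_dist z = length p'"
    proof (rule antisym)
      show "path_dist z \<le> length p'" using path_dist_le y yz by blast
      obtain q where q: "geodesic q z" by (rule ex_geodesic[OF z])
      have "is_path E b (q @ [inv_letter m]) u"
        using q y yz by (auto simp: is_path_append geodesic_def)
      then have "path_dist u \<le> Suc (length q)" using path_dist_le[of "q @ [inv_letter m]" u] by simp
      then show "length p' \<le> path_dist z" using p q p' by (simp add: geodesic_def)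
    qed
    moreover have "reduced p'" using p p' by (simp add: geodesic_def reduced_append)
    ultimately have "geodesic p' z" using y yz by (simp add: geodesic_def)
    moreover have "reduced (p' @ [inv_letter m])" using p p' by (simp add: geodesic_def)
    ultimately obtain q where "p' @ [inv_letter m] @ q \<in> loops E b"
      using geodesic_extends_to_loop[of p' z "inv_letter m" u] y(2) yz by blast
    then have "(p' @ [inv_letter m]) @ q \<in> loops E' b'" using sub by auto
    then have "is_path E' b' (p @ q) b'" by (simp add: loops_path p')
    then obtain u' where u': "is_path E' b' p u'" by (auto simp: is_path_append)
    then obtain z' where "step E' z' (inv_letter m) u'"
      using p' by (auto simp: is_path_append)
    then show ?thesis using that[OF path u', of z'] by simp
  qed
qed

end

section \<open>Uniqueness of the graphical representation\<close>

text \<open>Two words readable at the base point lead to the same vertex exactly if one followed by the inverse of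
  the other is, once reduced, a closed path at the base point.\<close>

lemma same_end_transfer:
  assumes "folded E" "folded E'" "loops E b \<subseteq> loops E' b'"
    and "is_path E b w1 x" "is_path E b w2 x"
    and "is_path E' b' w1 x1" "is_path E' b' w2 x2"
  shows "x1 = x2"
proof -
  let ?h = "reduce (w1 @ inv_word w2)"
  have "?h \<in> loops E b"
    using assms(4,5) by (auto simp: loops_def is_path_append intro!: is_path_reduce[OF assms(1)])
  then have "is_path E' b' ?h b'" by (rule loops_path[OF subsetD[OF assms(3)]])
  then have "is_path E' x1 (inv_word w1 @ ?h @ w2) x2"
    using assms(6,7) by (auto simp: is_path_append)
  then have "is_path E' x1 (reduce (inv_word w1 @ ?h @ w2)) x2" by (rule is_path_reduce[OF assms(2)])
  moreover have "reduce (inv_word w1 @ ?h @ w2) = []"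
  proof -
    have "reduce (inv_word w1 @ ?h @ w2) = reduce (inv_word w1 @ reduce (?h @ w2))"
      by (simp only: reduce_reduce_right)
    also have "\<dots> = reduce (inv_word w1 @ (w1 @ inv_word w2) @ w2)"
      by (simp only: reduce_reduce_left reduce_reduce_right)
    also have "\<dots> = []"
      using reduce_cancel[of "inv_word w1 @ w1" w2 "[]"] by simp
    finally show ?thesis .
  qed
  ultimately show ?thesis by simp
qed

definition relabel :: "('v \<Rightarrow> 'w) \<Rightarrow> ('v \<times> 'a \<times> 'v) set \<Rightarrow> ('w \<times> 'a \<times> 'w) set" where
  "relabel \<phi> E = (\<lambda>(u, a, v). (\<phi> u, a, \<phi> v)) ` E"

lemma relabelI: "(u, a, v) \<in> E \<Longrightarrow> (\<phi> u, a, \<phi> v) \<in> relabel \<phi> E"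
  unfolding relabel_def by force

lemma step_relabel: "step E u x v \<Longrightarrow> step (relabel \<phi> E) (\<phi> u) x (\<phi> v)"
  by (simp add: step_def relabelI split: if_splits)

lemma is_path_relabel: "is_path E u w v \<Longrightarrow> is_path (relabel \<phi> E) (\<phi> u) w (\<phi> v)"
proof (induction w arbitrary: u)
  case (Cons x w)
  then obtain t where t: "step E u x t" "is_path E t w v" by auto
  show ?case using step_relabel[OF t(1), of \<phi>] Cons.IH[OF t(2)] by auto
qed simp

text \<open>The isomorphism to be constructed, as a relation: corresponding vertices are reached by a common word.\<close>

definition same_word :: "('v \<times> 'a \<times> 'v) set \<Rightarrow> 'v \<Rightarrow> ('w \<times> 'a \<times> 'w) set \<Rightarrow> 'w \<Rightarrow> 'v \<Rightarrow> 'w \<Rightarrow> bool" where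
  "same_word E b E' b' x x' \<longleftrightarrow> (\<exists>w. is_path E b w x \<and> is_path E' b' w x')"

context pointed_graph
begin

lemma same_word_total:
  assumes "loops E b \<subseteq> loops E' b'" "x \<in> V"
  shows "\<exists>x'. same_word E b E' b' x x'"
proof (cases "x = b")
  case True
  then show ?thesis by (auto simp: same_word_def intro!: exI[of _ "[]"])
next
  case False
  obtain p where p: "is_path E b p x"
    using is_path_if_connected[OF connected[OF base assms(2)]] by blast
  then have "p = butlast p @ [last p]" using False by (cases "p = []") auto
  then obtain y where "step E y (last p) x"
    using p by (metis is_path_snoc)
  then obtain w y' x' where "is_path E b w y" "is_path E' b' w y'" "step E' y' (last p) x'"
    using step_transfer[OF assms(1)] by blast
  then have "is_path E b (w @ [last p]) x \<and> is_path E' b' (w @ [last p]) x'"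
    using \<open>step E y (last p) x\<close> by (auto simp: is_path_append)
  then show ?thesis unfolding same_word_def by blast
qed

lemma edge_same_word:
  assumes "loops E b \<subseteq> loops E' b'" "(u, a, v) \<in> E"
  obtains u' v' where "same_word E b E' b' u u'" "same_word E b E' b' v v'" "(u', a, v') \<in> E'"
proof -
  have st: "step E u (a, True) v" using assms(2) by (simp add: step_def)
  obtain w u' v' where w: "is_path E b w u" "is_path E' b' w u'" "step E' u' (a, True) v'"
    using step_transfer[OF assms(1) st] .
  have "is_path E b (w @ [(a, True)]) v \<and> is_path E' b' (w @ [(a, True)]) v'"
    using w st by (auto simp: is_path_append)
  then show ?thesis using that w unfolding same_word_def by (auto simp: step_def)
qed

end

lemma graphical_representation_unique:
  assumes fin: "finite A" and adm: "admissible A (V, E) b" "admissible A (V', E') b'"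
    and same: "loops E b = loops E' b'"
  obtains \<phi> where "bij_betw \<phi> V V'" "\<phi> b = b'" "E' = relabel \<phi> E"
proof -
  interpret G: pointed_graph A V E b by unfold_locales (fact fin adm)+
  interpret G': pointed_graph A V' E' b' by unfold_locales (fact fin adm)+
  define R where "R = same_word E b E' b'"
  have sym: "same_word E' b' E b x' x \<longleftrightarrow> R x x'" for x x' by (auto simp: R_def same_word_def)
  have sub: "loops E b \<subseteq> loops E' b'" "loops E' b' \<subseteq> loops E b" using same by auto
  have fun1: "x1 = x2" if "R x x1" "R x x2" for x x1 x2
    using same_end_transfer[OF G.fold G'.fold sub(1)] that unfolding R_def same_word_def by blast
  have fun2: "x1 = x2" if "R x1 x" "R x2 x" for x x1 x2
    using same_end_transfer[OF G'.fold G.fold sub(2)] that unfolding R_def same_word_def by blast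
  have R_V: "x \<in> V" "x' \<in> V'" if "R x x'" for x x'
    using that is_path_set(2)[OF G.edges _ G.base] is_path_set(2)[OF G'.edges _ G'.base]
    by (auto simp: R_def same_word_def)
  have "\<forall>x\<in>V. \<exists>x'. R x x'" using G.same_word_total[OF sub(1)] by (simp add: R_def)
  then obtain \<phi> where \<phi>: "\<And>x. x \<in> V \<Longrightarrow> R x (\<phi> x)" by metis
  have \<phi>_eq: "\<phi> x = x'" if "R x x'" for x x' using fun1[OF _ that] \<phi> R_V(1)[OF that] by blast
  show ?thesis
  proof
    show "bij_betw \<phi> V V'"
    proof (rule bij_betw_imageI)
      show "inj_on \<phi> V" by (rule inj_onI) (metis \<phi> fun2)
      show "\<phi> ` V = V'"
      proof (intro equalityI subsetI)
        fix x' assume "x' \<in> V'"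
        then obtain x where "R x x'" using G'.same_word_total[OF sub(2)] by (auto simp: sym)
        then show "x' \<in> \<phi> ` V" using \<phi>_eq R_V by blast
      qed (use \<phi> R_V in blast)
    qed
    have "R b b'" by (auto simp: R_def same_word_def intro!: exI[of _ "[]"])
    then show "\<phi> b = b'" by (rule \<phi>_eq)
    show "E' = relabel \<phi> E"
    proof (intro equalityI subsetI)
      fix e assume "e \<in> E'"
      then obtain u' a v' where e: "e = (u', a, v')" "(u', a, v') \<in> E'" by (cases e) auto
      obtain u v where "R u u'" "R v v'" "(u, a, v) \<in> E"
        using G'.edge_same_word[OF sub(2) e(2)] by (auto simp: sym)
      then show "e \<in> relabel \<phi> E" using \<phi>_eq relabelI[of u a v E \<phi>] e by simp
    next
      fix e assume "e \<in> relabel \<phi> E"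
      then obtain u a v where e: "e = (\<phi> u, a, \<phi> v)" "(u, a, v) \<in> E" by (auto simp: relabel_def)
      obtain u' v' where "R u u'" "R v v'" "(u', a, v') \<in> E'"
        using G.edge_same_word[OF sub(1) e(2)] by (auto simp: R_def)
      then show "e \<in> E'" using \<phi>_eq e by simp
    qed
  qed
qed

section \<open>Labelled graphs above a subgroup\<close>

lemma relabel_cong: "E \<subseteq> V \<times> A \<times> V \<Longrightarrow> (\<And>v. v \<in> V \<Longrightarrow> \<phi> v = \<psi> v) \<Longrightarrow> relabel \<phi> E = relabel \<psi> E"
  unfolding relabel_def by (intro image_cong) auto

lemma relabel_inverse:
  assumes "E \<subseteq> V \<times> A \<times> V" "inj_on \<phi> V"
  shows "relabel (inv_into V \<phi>) (relabel \<phi> E) = E"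
proof -
  have "relabel (inv_into V \<phi>) (relabel \<phi> E) = relabel (inv_into V \<phi> \<circ> \<phi>) E"
    by (auto simp: relabel_def image_image case_prod_beta)
  also have "\<dots> = relabel id E"
    using assms by (intro relabel_cong) auto
  also have "\<dots> = E" by (auto simp: relabel_def image_iff)
  finally show ?thesis .
qed

context pointed_graph
begin

lemma relabel_subset: "relabel \<phi> E \<subseteq> \<phi> ` V \<times> A \<times> \<phi> ` V"
  using edges by (auto simp: relabel_def)

lemma folded_relabel:
  assumes "inj_on \<phi> V"
  shows "folded (relabel \<phi> E)"
proof -
  have eq: "x = y" if "\<phi> x = \<phi> y" "x \<in> V" "y \<in> V" for x y
    using assms that by (auto dest: inj_onD)
  have "v = v'" if "(u, a, v) \<in> relabel \<phi> E" "(u, a, v') \<in> relabel \<phi> E" for u a v v'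
    using that edges eq unfolding relabel_def by (auto; metis SigmaD1 SigmaD2 foldedD(1)[OF fold] subsetD)
  moreover have "u = u'" if "(u, a, v) \<in> relabel \<phi> E" "(u', a, v) \<in> relabel \<phi> E" for u u' a v
    using that edges eq unfolding relabel_def by (auto; metis SigmaD1 SigmaD2 foldedD(2)[OF fold] subsetD)
  ultimately show ?thesis by (auto simp: folded_def)
qed

lemma admissible_relabel:
  assumes inj: "inj_on \<phi> V"
  shows "admissible A (\<phi> ` V, relabel \<phi> E) (\<phi> b)"
proof -
  have fold': "folded (relabel \<phi> E)" by (rule folded_relabel[OF inj])
  have fin': "finite (relabel \<phi> E)" using finite_E by (simp add: relabel_def)
  have "A_graph A (\<phi> ` V, relabel \<phi> E)"
    using fold' finite_V relabel_subset by (simp add: A_graph_def folded_def)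
  moreover have "graph_connected (\<phi> ` V, relabel \<phi> E)"
    unfolding graph_connected_def
  proof (clarsimp)
    fix u v assume "u \<in> V" "v \<in> V"
    then obtain w where "is_path E u w v" using is_path_if_connected[OF connected] by metis
    then show "(\<phi> u, \<phi> v) \<in> (adjacency (relabel \<phi> E))\<^sup>*"
      by (rule is_path_adjacency[OF is_path_relabel])
  qed
  moreover have "trim (\<phi> ` V, relabel \<phi> E) (\<phi> b)"
    unfolding trim_def leaf_def
  proof (clarsimp)
    fix v assume v: "v \<in> V" "\<phi> v \<noteq> \<phi> b" "occurrences (relabel \<phi> E) (\<phi> v) \<le> Suc 0"
    have "letters_at E v \<subseteq> letters_at (relabel \<phi> E) (\<phi> v)"
      unfolding letters_at_def using step_relabel by fast
    then have "card (letters_at E v) \<le> card (letters_at (relabel \<phi> E) (\<phi> v))"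
      by (intro card_mono finite_letters_at fin')
    then have "occurrences E v \<le> 1"
      using v(3) by (simp add: occurrences_eq_card_letters[OF fold finite_E]
          occurrences_eq_card_letters[OF fold' fin'])
    moreover have "v \<noteq> b" using v by auto
    ultimately show False
      using admissible v(1) by (auto simp: admissible_def trim_def leaf_def)
  qed
  ultimately show ?thesis using base by (simp add: admissible_def)
qed

lemma loops_relabel:
  assumes inj: "inj_on \<phi> V"
  shows "loops (relabel \<phi> E) (\<phi> b) = loops E b"
proof
  show "loops E b \<subseteq> loops (relabel \<phi> E) (\<phi> b)"
    unfolding loops_def by (auto intro: is_path_relabel[of E b _ b \<phi>])
  have "is_path E b w b" if "is_path (relabel \<phi> E) (\<phi> b) w (\<phi> b)" for w
    using is_path_relabel[OF that, of "inv_into V \<phi>"] base inj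
    by (simp add: relabel_inverse[OF edges inj])
  then show "loops (relabel \<phi> E) (\<phi> b) \<subseteq> loops E b" by (auto simp: loops_def)
qed

text \<open>Rigidity: every vertex is the end of a path from the base point, so its new name is determined
  by the relabelled graph.\<close>

lemma relabel_eq_imp:
  assumes "inj_on \<phi> V" "relabel \<phi> E = relabel \<psi> E" "\<phi> b = \<psi> b" "v \<in> V"
  shows "\<phi> v = \<psi> v"
proof -
  obtain w where w: "is_path E b w v" using is_path_if_connected[OF connected[OF base assms(4)]] by blast
  show ?thesis
    using is_path_det[OF folded_relabel[OF assms(1)] is_path_relabel[OF w, of \<phi>]]
      is_path_relabel[OF w, of \<psi>] assms(2,3) by simp
qed

end

definition admissible_edges :: "'a set \<Rightarrow> nat \<Rightarrow> (nat \<times> 'a \<times> nat) set set" where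
  "admissible_edges A n = {E. admissible A ({..<n}, E) 0}"

lemma pointed_graph_admissible_edges:
  "finite A \<Longrightarrow> E \<in> admissible_edges A n \<Longrightarrow> pointed_graph A {..<n} E 0"
  by unfold_locales (auto simp: admissible_edges_def)

lemma finite_admissible_edges:
  assumes "finite A"
  shows "finite (admissible_edges A n)"
proof (rule finite_subset)
  show "admissible_edges A n \<subseteq> Pow ({..<n} \<times> A \<times> {..<n})"
    using pointed_graph.edges[OF pointed_graph_admissible_edges[OF assms]] by blast
qed (use assms in simp)

text \<open>An isomorphism between two graphs on {..<n} that fixes the base point 0 is a permutation of the other vertices.\<close>

lemma fibre_eq:
  assumes fin: "finite A" and E: "E \<in> admissible_edges A n"
  shows "{E' \<in> admissible_edges A n. loops E' 0 = loops E 0} =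
    (\<lambda>\<phi>. relabel \<phi> E) ` {\<phi>. \<phi> permutes {1..<n}}"
proof (intro equalityI subsetI)
  interpret pointed_graph A "{..<n}" E 0 by (rule pointed_graph_admissible_edges[OF fin E])
  fix E' assume "E' \<in> (\<lambda>\<phi>. relabel \<phi> E) ` {\<phi>. \<phi> permutes {1..<n}}"
  then obtain \<phi> where \<phi>: "\<phi> permutes {1..<n}" "E' = relabel \<phi> E" by auto
  have 0: "\<phi> 0 = 0" using permutes_not_in[OF \<phi>(1), of 0] by simp
  have "\<phi> permutes {..<n}" using \<phi>(1) by (rule permutes_subset) auto
  then have "\<phi> ` {..<n} = {..<n}" "inj_on \<phi> {..<n}"
    by (simp_all add: permutes_image permutes_inj_on)
  then have "admissible A ({..<n}, E') 0" "loops E' 0 = loops E 0"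
    unfolding \<phi>(2) using admissible_relabel[of \<phi>] loops_relabel[of \<phi>] 0 by simp_all
  then show "E' \<in> {E' \<in> admissible_edges A n. loops E' 0 = loops E 0}"
    by (simp add: admissible_edges_def)
next
  interpret pointed_graph A "{..<n}" E 0 by (rule pointed_graph_admissible_edges[OF fin E])
  fix E' assume E': "E' \<in> {E' \<in> admissible_edges A n. loops E' 0 = loops E 0}"
  then have adm': "admissible A ({..<n}, E') 0" and same: "loops E 0 = loops E' 0"
    by (simp_all add: admissible_edges_def)
  obtain \<phi> where \<phi>: "bij_betw \<phi> {..<n} {..<n}" "\<phi> 0 = 0" "E' = relabel \<phi> E"
    by (rule graphical_representation_unique[OF fin admissible adm' same])
  define \<psi> where "\<psi> = (\<lambda>x. if x < n then \<phi> x else x)"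
  have "bij_betw \<psi> {..<n} {..<n}"
    by (rule bij_betw_cong[THEN iffD2, OF _ \<phi>(1)]) (simp add: \<psi>_def)
  then have "\<psi> permutes {..<n}" by (rule bij_imp_permutes) (auto simp: \<psi>_def)
  then have "\<psi> permutes {1..<n}"
    by (rule permutes_superset) (use \<phi>(2) in \<open>auto simp: \<psi>_def Suc_le_eq\<close>)
  then have "\<psi> \<in> {\<phi>. \<phi> permutes {1..<n}}" by simp
  moreover have "E' = relabel \<psi> E"
    unfolding \<phi>(3) by (rule relabel_cong[OF edges]) (simp add: \<psi>_def)
  ultimately show "E' \<in> (\<lambda>\<phi>. relabel \<phi> E) ` {\<phi>. \<phi> permutes {1..<n}}"
    by (intro image_eqI[where x = \<psi>])
qed

lemma card_fibre:
  assumes fin: "finite A" and E: "E \<in> admissible_edges A n"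
  shows "card {E' \<in> admissible_edges A n. loops E' 0 = loops E 0} = fact (n - 1)"
proof -
  interpret pointed_graph A "{..<n}" E 0 by (rule pointed_graph_admissible_edges[OF fin E])
  have "inj_on (\<lambda>\<phi>. relabel \<phi> E) {\<phi>. \<phi> permutes {1..<n}}"
  proof (rule inj_onI)
    fix \<phi> \<psi> assume "\<phi> \<in> {\<phi>. \<phi> permutes {1..<n}}" "\<psi> \<in> {\<phi>. \<phi> permutes {1..<n}}"
      and eq: "relabel \<phi> E = relabel \<psi> E"
    then have p: "\<phi> permutes {1..<n}" "\<psi> permutes {1..<n}" by simp_all
    have 0: "\<phi> 0 = \<psi> 0" using permutes_not_in[OF p(1), of 0] permutes_not_in[OF p(2), of 0] by simp
    have "\<phi> x = \<psi> x" for x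
    proof (cases "x \<in> {1..<n}")
      case True
      then show ?thesis using relabel_eq_imp[OF permutes_inj_on[OF p(1)] eq 0, of x] by simp
    next
      case False
      then show ?thesis by (simp add: permutes_not_in[OF p(1)] permutes_not_in[OF p(2)])
    qed
    then show "\<phi> = \<psi>" by (rule ext)
  qed
  then have "card ((\<lambda>\<phi>. relabel \<phi> E) ` {\<phi>. \<phi> permutes {1..<n}}) = card {\<phi>. \<phi> permutes {1..<n}}"
    by (rule card_image)
  also have "\<dots> = fact (n - 1)" by (rule card_permutations) simp_all
  finally show ?thesis unfolding fibre_eq[OF assms] .
qed

lemma subgroups_of_size_eq:
  assumes fin: "finite A"
  shows "subgroups_of_size A n = (\<lambda>E. loops E 0) ` admissible_edges A n"
proof (intro equalityI subsetI)
  fix H assume "H \<in> subgroups_of_size A n"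
  then have "has_size A H n" by (simp add: subgroups_of_size_def)
  then obtain \<Gamma> :: "(nat, 'a) lgraph" and v where
    "graphical_representation A \<Gamma> v H" and n: "card (fst \<Gamma>) = n"
    unfolding has_size_def by (elim exE conjE) (rule that)
  then have adm: "admissible A \<Gamma> v" and H: "H = loops (snd \<Gamma>) v"
    by (simp_all add: graphical_representation_def loops_def)
  obtain V E where \<Gamma>: "\<Gamma> = (V, E)" by (cases \<Gamma>)
  interpret pointed_graph A V E v by unfold_locales (use adm \<Gamma> fin in simp_all)
  have "card (V - {v}) = card {1..<n}" using base n \<Gamma> by simp
  then have "\<exists>f. bij_betw f (V - {v}) {1..<n}"
    by (rule finite_same_card_bij[rotated 2]) (simp_all add: finite_V)
  then obtain f where f: "bij_betw f (V - {v}) {1..<n}" ..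
  define \<phi> where "\<phi> = f(v := 0)"
  have "0 < card V" using base finite_V by (auto simp: card_gt_0_iff)
  then have "0 < n" using n \<Gamma> by simp
  have "bij_betw \<phi> (V - {v} \<union> {v}) ({1..<n} \<union> {0})"
  proof (rule bij_betw_combine)
    show "bij_betw \<phi> (V - {v}) {1..<n}"
      by (rule bij_betw_cong[THEN iffD2, OF _ f]) (simp add: \<phi>_def)
  qed (auto simp: \<phi>_def)
  moreover have V: "V - {v} \<union> {v} = V" and n': "{1..<n} \<union> {0} = {..<n}"
    using base \<open>0 < n\<close> by auto
  ultimately have "bij_betw \<phi> V {..<n}" by (simp only: V n')
  then have bij: "inj_on \<phi> V" "\<phi> ` V = {..<n}" by (simp_all add: bij_betw_def)
  have "\<phi> v = 0" by (simp add: \<phi>_def)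
  then have "relabel \<phi> E \<in> admissible_edges A n" "H = loops (relabel \<phi> E) 0"
    using admissible_relabel[OF bij(1)] loops_relabel[OF bij(1)]
    by (simp_all add: admissible_edges_def H \<Gamma> bij(2))
  then show "H \<in> (\<lambda>E. loops E 0) ` admissible_edges A n"
    by (intro image_eqI[where x = "relabel \<phi> E"])
next
  fix H assume "H \<in> (\<lambda>E. loops E 0) ` admissible_edges A n"
  then obtain E where E: "E \<in> admissible_edges A n" "H = loops E 0" by auto
  interpret pointed_graph A "{..<n}" E 0 by (rule pointed_graph_admissible_edges[OF fin E(1)])
  have "fin_gen_subgroup (free_group A) H"
    unfolding E(2) by (rule fin_gen_loops[OF fold edges finite_E connected[OF base] base])
  moreover have "graphical_representation A ({..<n}, E) 0 H"
    using admissible E(2) by (simp add: graphical_representation_def loops_def)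
  then have "has_size A H n"
    unfolding has_size_def by (intro exI[of _ "({..<n}, E)"] exI[of _ 0]) simp
  ultimately show "H \<in> subgroups_of_size A n" by (simp add: subgroups_of_size_def)
qed

text \<open>All fibres have the same cardinality, so the uniform distribution on subgroups may be
  replaced by the uniform distribution on labelled admissible graphs.\<close>

lemma card_subgroups_of_size:
  assumes fin: "finite A"
  shows "card {H \<in> subgroups_of_size A n. P H} * fact (n - 1) =
    card {E \<in> admissible_edges A n. P (loops E 0)}"
proof -
  let ?X = "{E \<in> admissible_edges A n. P (loops E 0)}" and ?Y = "{H \<in> subgroups_of_size A n. P H}"
  have finX: "finite ?X" using finite_admissible_edges[OF fin] by simp
  have finY: "finite ?Y" using subgroups_of_size_eq[OF fin] finite_admissible_edges[OF fin] by simp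
  have img: "(\<lambda>E. loops E 0) ` ?X \<subseteq> ?Y" unfolding subgroups_of_size_eq[OF fin] by auto
  have "card ?X = (\<Sum>H\<in>?Y. card {E \<in> ?X. loops E 0 = H})"
    using sum.group[OF finX finY img, of "\<lambda>_. 1::nat"] by (simp only: card_eq_sum)
  also have "\<dots> = (\<Sum>H\<in>?Y. fact (n - 1))"
  proof (rule sum.cong[OF refl])
    fix H assume "H \<in> ?Y"
    then obtain E where E: "E \<in> admissible_edges A n" "H = loops E 0" and "P H"
      unfolding subgroups_of_size_eq[OF fin] by auto
    then have "{E \<in> ?X. loops E 0 = H} = {E' \<in> admissible_edges A n. loops E' 0 = loops E 0}"
      by auto
    then show "card {E \<in> ?X. loops E 0 = H} = fact (n - 1)" using card_fibre[OF fin E(1)] by simp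
  qed
  finally show ?thesis by simp
qed

lemma prob_finite_index_eq:
  assumes fin: "finite A" and ne: "admissible_edges A n \<noteq> {}"
  shows "prob_finite_index A n =
    card {E \<in> admissible_edges A n. finite_index (free_group A) (loops E 0)} /
    card (admissible_edges A n)"
proof -
  define S where "S = subgroups_of_size A n"
  define P where "P H \<longleftrightarrow> finite_index (free_group A) H" for H :: "'a letter list set"
  have S: "finite S" "S \<noteq> {}"
    using finite_admissible_edges[OF fin] ne by (simp_all add: S_def subgroups_of_size_eq[OF fin])
  have count: "card {H \<in> S. Q H} * fact (n - 1) = card {E \<in> admissible_edges A n. Q (loops E 0)}" for Q
    unfolding S_def by (rule card_subgroups_of_size[OF fin])
  have "S \<inter> {H. P H} = {H \<in> S. P H}" by auto
  then have "prob_finite_index A n = card {H \<in> S. P H} / card S"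
    using measure_pmf_of_set[OF S(2,1), of "{H. P H}"]
    by (simp add: prob_finite_index_def S_def P_def)
  also have "\<dots> = real (card {H \<in> S. P H} * fact (n - 1)) / real (card {H \<in> S. True} * fact (n - 1))"
    by simp
  also have "\<dots> = card {E \<in> admissible_edges A n. P (loops E 0)} / card (admissible_edges A n)"
    unfolding count by simp
  finally show ?thesis by (simp add: P_def)
qed

section \<open>Finite index forces a complete graph\<close>

text \<open>Let p be a reduced word leading to u. If p ends with the inverse of a, then its last edge is the required one.
  Otherwise w = p a is reduced. With another letter c of the alphabet, two of the words w c^i lie in the
  same coset, and then w c^m w^-1 belongs to the subgroup for some m > 0. This word is reduced, so
  it can be read at the base point, and in particular a can be read at u.\<close>

lemma complete_if_finite_index:
  assumes fin: "finite A" and r: "card A \<ge> 2" and adm: "admissible A (V, E) b"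
    and idx: "finite_index (free_group A) (loops E b)" and u: "u \<in> V" and a: "a \<in> A"
  shows "\<exists>v. (u, a, v) \<in> E"
proof -
  interpret pointed_graph A V E b by unfold_locales (fact adm fin)+
  interpret F: group "free_group A" by (rule group_free_group)
  have sg: "subgroup (loops E b) (free_group A)" by (rule subgroup_loops[OF fold edges])
  obtain p where p: "reduced p" "is_path E b p u"
    using ex_geodesic[OF u] unfolding geodesic_def by blast
  show ?thesis
  proof (cases "reduced (p @ [(a, True)])")
    case False
    then have "p \<noteq> []" "last p = (a, False)"
      using p by (auto simp: reduced_append inv_letter_def prod_eq_iff)
    then obtain p' where "p = p' @ [(a, False)]" by (metis append_butlast_last_id)
    then show ?thesis using p(2) by (auto simp: is_path_snoc step_def)
  next
    case True
    define w where "w = p @ [(a, True)]"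
    obtain c where c: "c \<in> A" "c \<noteq> a"
    proof -
      have "\<not> A \<subseteq> {a}" using r card_mono[of "{a}" A] by auto
      then show ?thesis using that by blast
    qed
    define g where "g i = w @ replicate i (c, True)" for i
    have red_rep: "reduced (replicate i (c, True))" for i
      by (induction i) (auto simp: reduced_Cons inv_letter_def)
    have w_red: "reduced w" and w_last: "w \<noteq> []" "last w = (a, True)"
      using True by (auto simp: w_def)
    have g_car: "g i \<in> carrier (free_group A)" for i
    proof -
      have "reduced (g i)"
        using w_red w_last red_rep[of i] c unfolding g_def
        by (cases i) (auto simp: reduced_append inv_letter_def)
      moreover have "set p \<subseteq> A \<times> UNIV" by (rule is_path_set(1)[OF edges p(2)])
      ultimately show ?thesis using a c by (auto simp: carrier_free_group g_def w_def)
    qed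
    have "range (\<lambda>i. loops E b #>\<^bsub>free_group A\<^esub> g i) \<subseteq> rcosets\<^bsub>free_group A\<^esub> (loops E b)"
      using g_car F.rcosetsI[OF subgroup.subset[OF sg]] by blast
    then have "finite (range (\<lambda>i. loops E b #>\<^bsub>free_group A\<^esub> g i))"
      using idx finite_subset unfolding finite_index_def by blast
    then have "\<not> inj (\<lambda>i. loops E b #>\<^bsub>free_group A\<^esub> g i)" using finite_imageD infinite_UNIV_nat by blast
    then obtain i j where ij: "i < j" and
      same: "loops E b #>\<^bsub>free_group A\<^esub> g i = loops E b #>\<^bsub>free_group A\<^esub> g j"
      unfolding inj_def by (metis linorder_neqE_nat)
    have "g j \<in> loops E b #>\<^bsub>free_group A\<^esub> g i"
      using F.rcos_self[OF g_car sg] same by simp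
    then obtain h where h: "h \<in> loops E b" "g j = reduce (h @ g i)"
      by (auto simp: r_coset_def mult_free_group)
    have h_red: "reduced h" using h(1) by (simp add: loops_def)
    have "h = reduce (g j @ inv_word (g i))"
    proof -
      have "reduce (g j @ inv_word (g i)) = reduce (h @ g i @ inv_word (g i))"
        unfolding h(2) by (simp only: reduce_reduce_left append_assoc)
      also have "\<dots> = h"
        using reduce_cancel[of h "inv_word (g i)" "[]"] h_red by (simp add: reduce_reduced)
      finally show ?thesis by simp
    qed
    also have "g j @ inv_word (g i) =
        (w @ replicate (j - i) (c, True)) @ inv_word (inv_word (replicate i (c, True))) @
          inv_word (replicate i (c, True)) @ inv_word w"
    proof -
      have "replicate j (c, True) = replicate (j - i) (c, True) @ replicate i (c, True)"
        using ij by (simp flip: replicate_add)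
      then show ?thesis by (simp add: g_def)
    qed
    also have "reduce \<dots> = reduce ((w @ replicate (j - i) (c, True)) @ inv_word w)"
      by (rule reduce_cancel)
    also have "\<dots> = w @ replicate (j - i) (c, True) @ inv_word w"
    proof -
      have "reduced ((w @ replicate (j - i) (c, True)) @ inv_word w)"
        using w_red w_last red_rep[of "j - i"] c ij
        by (auto simp: reduced_append inv_letter_def hd_inv_word)
      then show ?thesis by (simp add: reduce_reduced)
    qed
    finally have "is_path E b (w @ replicate (j - i) (c, True) @ inv_word w) b"
      using loops_path[OF h(1)] by simp
    then obtain v where "is_path E b p v" "\<exists>t. (v, a, t) \<in> E"
      by (auto simp: is_path_append w_def step_def)
    then show ?thesis using is_path_det[OF fold p(2)] by blast
  qed
qed

section \<open>Counting partial injections\<close>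

definition partial_injections :: "'u set \<Rightarrow> 'v set \<Rightarrow> ('u \<times> 'v) set set" where
  "partial_injections X Y = {R. R \<subseteq> X \<times> Y \<and>
    (\<forall>x y y'. (x, y) \<in> R \<and> (x, y') \<in> R \<longrightarrow> y = y') \<and>
    (\<forall>x x' y. (x, y) \<in> R \<and> (x', y) \<in> R \<longrightarrow> x = x')}"

lemma partial_injectionsI:
  assumes "R \<subseteq> X \<times> Y" "\<And>x y y'. (x, y) \<in> R \<Longrightarrow> (x, y') \<in> R \<Longrightarrow> y = y'"
    "\<And>x x' y. (x, y) \<in> R \<Longrightarrow> (x', y) \<in> R \<Longrightarrow> x = x'"
  shows "R \<in> partial_injections X Y"
  unfolding partial_injections_def using assms by blast

lemma partial_injectionsD:
  assumes "R \<in> partial_injections X Y"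
  shows "R \<subseteq> X \<times> Y"
    and "(x, y) \<in> R \<Longrightarrow> (x, y') \<in> R \<Longrightarrow> y = y'"
    and "(x, y) \<in> R \<Longrightarrow> (x', y) \<in> R \<Longrightarrow> x = x'"
  using assms unfolding partial_injections_def mem_Collect_eq by metis+

text \<open>The number of partial injections between sets of m and n elements: k is the common cardinality of
  domain and range, which are joined by one of k! bijections.\<close>

definition num_pinj :: "nat \<Rightarrow> nat \<Rightarrow> nat" where
  "num_pinj m n = (\<Sum>k\<le>m. (m choose k) * (n choose k) * fact k)"

lemma finite_partial_injections:
  "finite X \<Longrightarrow> finite Y \<Longrightarrow> finite (partial_injections X Y)"
  by (rule finite_subset[of _ "Pow (X \<times> Y)"]) (auto simp: partial_injections_def)

lemma num_pinj_Suc: "num_pinj (Suc m) n = num_pinj m n + n * num_pinj m (n - 1)"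
proof -
  have absorb: "(n choose Suc j) * fact (Suc j) = n * ((n - 1 choose j) * fact j)" for j
  proof -
    have "(n choose Suc j) * fact (Suc j) = (Suc j * (n choose Suc j)) * fact j"
      by (simp add: algebra_simps)
    also have "\<dots> = n * ((n - 1 choose j) * fact j)" by (simp only: binomial_absorption mult.assoc)
    finally show ?thesis .
  qed
  have "num_pinj (Suc m) n = 1 + (\<Sum>j\<le>m. (Suc m choose Suc j) * (n choose Suc j) * fact (Suc j))"
    unfolding num_pinj_def by (subst sum.atMost_Suc_shift) simp
  also have "(\<Sum>j\<le>m. (Suc m choose Suc j) * (n choose Suc j) * fact (Suc j)) =
      (\<Sum>j\<le>m. (m choose Suc j) * (n choose Suc j) * fact (Suc j)) +
      (\<Sum>j\<le>m. (m choose j) * ((n choose Suc j) * fact (Suc j)))"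
    by (simp only: binomial_Suc_Suc flip: sum.distrib) (simp add: algebra_simps)
  also have "(\<Sum>j\<le>m. (m choose j) * ((n choose Suc j) * fact (Suc j))) = n * num_pinj m (n - 1)"
    unfolding absorb num_pinj_def sum_distrib_left by (simp add: algebra_simps)
  also have "1 + ((\<Sum>j\<le>m. (m choose Suc j) * (n choose Suc j) * fact (Suc j)) +
      n * num_pinj m (n - 1)) = num_pinj m n + n * num_pinj m (n - 1)"
  proof -
    have "num_pinj m n = (\<Sum>k\<le>Suc m. (m choose k) * (n choose k) * fact k)"
      by (simp add: num_pinj_def)
    also have "\<dots> = 1 + (\<Sum>j\<le>m. (m choose Suc j) * (n choose Suc j) * fact (Suc j))"
      by (subst sum.atMost_Suc_shift) simp
    finally show ?thesis by simp
  qed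
  finally show ?thesis .
qed

text \<open>This decomposition, by the value at x if there is one, matches the recurrence of \<open>num_pinj\<close>.\<close>

lemma partial_injections_insert:
  assumes "x \<notin> X"
  shows "partial_injections (insert x X) Y =
    partial_injections X Y \<union> (\<Union>y\<in>Y. insert (x, y) ` partial_injections X (Y - {y}))"
proof (intro equalityI subsetI)
  fix R assume R: "R \<in> partial_injections (insert x X) Y"
  show "R \<in> partial_injections X Y \<union> (\<Union>y\<in>Y. insert (x, y) ` partial_injections X (Y - {y}))"
  proof (cases "\<exists>y. (x, y) \<in> R")
    case True
    then obtain y where y: "(x, y) \<in> R" by blast
    have "y \<in> Y" using R y by (auto simp: partial_injections_def)
    moreover have "R - {(x, y)} \<in> partial_injections X (Y - {y})"
      using R y unfolding partial_injections_def by blast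
    moreover have "R = insert (x, y) (R - {(x, y)})" using y by blast
    ultimately have "R \<in> (\<Union>y\<in>Y. insert (x, y) ` partial_injections X (Y - {y}))"
      by (intro UN_I[of y] image_eqI[where x = "R - {(x, y)}"])
    then show ?thesis by simp
  next
    case False
    moreover have "R \<subseteq> insert x X \<times> Y" using R by (simp add: partial_injections_def)
    ultimately have "R \<subseteq> X \<times> Y" by auto
    then have "R \<in> partial_injections X Y" using R by (simp add: partial_injections_def)
    then show ?thesis by simp
  qed
next
  fix R
  assume "R \<in> partial_injections X Y \<union> (\<Union>y\<in>Y. insert (x, y) ` partial_injections X (Y - {y}))"
  then show "R \<in> partial_injections (insert x X) Y"
  proof
    assume "R \<in> (\<Union>y\<in>Y. insert (x, y) ` partial_injections X (Y - {y}))"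
    then obtain y S where y: "y \<in> Y" and S: "S \<in> partial_injections X (Y - {y})"
      and R: "R = insert (x, y) S" by blast
    note S = partial_injectionsD[OF S]
    show ?thesis
      unfolding R by (rule partial_injectionsI) (use S y assms in auto)
  qed (auto simp: partial_injections_def)
qed

lemma card_partial_injections:
  fixes X :: "'u set" and Y :: "'v set"
  assumes "finite X" "finite Y"
  shows "card (partial_injections X Y) = num_pinj (card X) (card Y)"
  using assms
proof (induction X arbitrary: Y rule: finite_induct)
  case empty
  have "partial_injections ({} :: 'u set) Y = {{}}" by (auto simp: partial_injections_def)
  then show ?case by (simp add: num_pinj_def)
next
  case (insert x X)
  let ?U = "\<lambda>y. insert (x, y) ` partial_injections X (Y - {y})"
  have no_x: "(x, y) \<notin> R" if "R \<in> partial_injections X Y'" for R y Y'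
    using that insert.hyps(2) by (auto simp: partial_injections_def)
  have fin: "finite (?U y)" for y using insert by (simp add: finite_partial_injections)
  have "card (partial_injections (insert x X) Y) =
      card (partial_injections X Y) + card (\<Union>y\<in>Y. ?U y)"
    unfolding partial_injections_insert[OF insert.hyps(2)]
  proof (rule card_Un_disjoint)
    show "partial_injections X Y \<inter> (\<Union>y\<in>Y. ?U y) = {}" using no_x[of _ Y] by auto
  qed (use insert fin in \<open>simp_all add: finite_partial_injections\<close>)
  also have "card (\<Union>y\<in>Y. ?U y) = (\<Sum>y\<in>Y. card (?U y))"
  proof (rule card_UN_disjoint)
    show "\<forall>y\<in>Y. \<forall>y'\<in>Y. y \<noteq> y' \<longrightarrow> ?U y \<inter> ?U y' = {}"
    proof (intro ballI impI)
      fix y y' :: 'v assume "y \<noteq> y'"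
      then have "insert (x, y) R \<noteq> insert (x, y') S"
        if "S \<in> partial_injections X (Y - {y'})" for R S
        using no_x[OF that, of y] by blast
      then show "?U y \<inter> ?U y' = {}" by blast
    qed
  qed (use insert fin in auto)
  also have "\<dots> = (\<Sum>y\<in>Y. num_pinj (card X) (card Y - 1))"
  proof (rule sum.cong[OF refl])
    fix y assume "y \<in> Y"
    have "inj_on (insert (x, y)) (partial_injections X (Y - {y}))"
    proof (rule inj_onI)
      fix R S assume "R \<in> partial_injections X (Y - {y})" "S \<in> partial_injections X (Y - {y})"
        "insert (x, y) R = insert (x, y) S"
      then show "R = S" using no_x[of R _ y] no_x[of S _ y] insert_ident[of "(x, y)" R S] by simp
    qed
    then show "card (?U y) = num_pinj (card X) (card Y - 1)"
      using insert \<open>y \<in> Y\<close> by (simp add: card_image)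
  qed
  finally show ?case using insert by (simp add: num_pinj_Suc)
qed

lemma num_pinj_commute: "num_pinj m n = num_pinj n m"
proof -
  have "partial_injections {..<n} {..<m} = converse ` partial_injections {..<m} {..<n}"
  proof (intro equalityI subsetI)
    fix R assume "R \<in> partial_injections {..<n} {..<m}"
    then have "R\<inverse> \<in> partial_injections {..<m} {..<n}"
      unfolding partial_injections_def by blast
    then show "R \<in> converse ` partial_injections {..<m} {..<n}"
      by (rule rev_image_eqI) simp
  next
    fix R assume "R \<in> converse ` partial_injections {..<m} {..<n}"
    then show "R \<in> partial_injections {..<n} {..<m}"
      unfolding partial_injections_def by blast
  qed
  moreover have "inj_on converse (partial_injections {..<m} {..<n})"
    by (rule inj_onI) simp
  ultimately have "card (partial_injections {..<n} {..<m}) = card (partial_injections {..<m} {..<n})"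
    by (simp add: card_image)
  then show ?thesis by (simp add: card_partial_injections)
qed

lemma num_pinj_remove_both: "n * num_pinj (n - 1) (n - 1) \<le> num_pinj n n"
  by (cases n) (simp_all add: num_pinj_Suc)

text \<open>The quotient \<open>num_pinj (n - 1) n / num_pinj n n\<close> is the probability that a random partial injection
  of n points is undefined at a given one. The recurrences in both arguments express this quotient for
  n + 1 through the one for n, and the bound 1 / sqrt n reproduces itself.\<close>

lemma num_pinj_remove_one:
  assumes "n \<ge> 1"
  shows "sqrt n * num_pinj (n - 1) n \<le> num_pinj n n"
  using assms
proof (induction n rule: nat_induct_at_least)
  case base
  show ?case by (simp add: num_pinj_def)
next
  case (Suc n)
  define x y where "x = real (num_pinj n n)" and "y = real (num_pinj (n - 1) n)"
  define s t where "s = sqrt (real n)" and "t = sqrt (real (Suc n))"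
  have y': "real (num_pinj n (Suc n)) = x + n * y"
    unfolding num_pinj_commute[of n "Suc n"] num_pinj_Suc[of n n] num_pinj_commute[of n "n - 1"]
    by (simp add: x_def y_def)
  have x': "real (num_pinj (Suc n) (Suc n)) = x + n * y + (n + 1) * x"
    using num_pinj_Suc[of n "Suc n"] y' by (simp add: x_def algebra_simps)
  have IH: "s * y \<le> x" using Suc.IH by (simp add: x_def y_def s_def)
  have s: "s \<ge> 0" "s * s = n" and t: "t \<ge> 1" "t * t = n + 1" "s \<le> t" "t \<le> 1 + s"
  proof -
    show "t \<le> 1 + s" unfolding s_def t_def by (rule real_le_lsqrt) (auto simp: power2_eq_square algebra_simps)
  qed (auto simp: s_def t_def)
  have "n * y \<le> s * x"
    using mult_left_mono[OF IH s(1)] s(2) by (simp flip: mult.assoc)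
  then have "(t - 1) * (x + n * y) \<le> (t - 1) * (x + s * x)"
    using t(1) by (intro mult_left_mono) auto
  also have "\<dots> = x * (t * s + t - 1 - s)" by (simp add: algebra_simps)
  also have "\<dots> \<le> x * (n + 1)"
  proof (rule mult_left_mono)
    have "t * s \<le> t * t" using t by (intro mult_left_mono) auto
    then show "t * s + t - 1 - s \<le> n + 1" using t by simp
  qed (simp add: x_def)
  finally have "t * (x + n * y) \<le> x + n * y + (n + 1) * x" by (simp add: algebra_simps)
  then show ?case by (simp add: x' y' t_def)
qed

lemma num_pinj_pos: "num_pinj n n > 0"
  unfolding num_pinj_def by (rule sum_pos2[of _ 0]) auto

section \<open>Counting labelled graphs\<close>

definition label_edges :: "('v \<times> 'a \<times> 'v) set \<Rightarrow> 'a \<Rightarrow> ('v \<times> 'v) set" where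
  "label_edges E a = {(u, v). (u, a, v) \<in> E}"

definition graphs_with_labels :: "'a set \<Rightarrow> 'v set \<Rightarrow> ('a \<Rightarrow> ('v \<times> 'v) set set) \<Rightarrow> ('v \<times> 'a \<times> 'v) set set" where
  "graphs_with_labels A V F = {E. E \<subseteq> V \<times> A \<times> V \<and> (\<forall>a\<in>A. label_edges E a \<in> F a)}"

lemma finite_graphs_with_labels:
  assumes "finite A" "finite V"
  shows "finite (graphs_with_labels A V F)"
proof (rule finite_subset)
  show "graphs_with_labels A V F \<subseteq> Pow (V \<times> A \<times> V)"
    unfolding graphs_with_labels_def by (rule subsetI) simp
qed (use assms in simp)

lemma card_graphs_with_labels:
  fixes F :: "'a \<Rightarrow> ('v \<times> 'v) set set"
  assumes "finite A" and F: "\<And>a. a \<in> A \<Longrightarrow> F a \<subseteq> Pow (V \<times> V)"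
  shows "card (graphs_with_labels A V F) = (\<Prod>a\<in>A. card (F a))"
proof -
  define dec where "dec g = {(u, a, v). a \<in> A \<and> (u, v) \<in> g a}" for g :: "'a \<Rightarrow> ('v \<times> 'v) set"
  have lab: "label_edges (dec g) a = g a" if "a \<in> A" for g a
    using that by (auto simp: label_edges_def dec_def)
  have "bij_betw (\<lambda>E. \<lambda>a\<in>A. label_edges E a) (graphs_with_labels A V F) (PiE A F)"
  proof (rule bij_betw_byWitness[where f' = dec])
    show "\<forall>E\<in>graphs_with_labels A V F. dec (\<lambda>a\<in>A. label_edges E a) = E"
      by (auto simp: graphs_with_labels_def dec_def label_edges_def)
    show "\<forall>g\<in>PiE A F. (\<lambda>a\<in>A. label_edges (dec g) a) = g"
    proof
      fix g assume g: "g \<in> PiE A F"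
      have "(\<lambda>a\<in>A. label_edges (dec g) a) = restrict g A"
        by (rule restrict_ext) (rule lab)
      then show "(\<lambda>a\<in>A. label_edges (dec g) a) = g" using g by simp
    qed
    show "(\<lambda>E. \<lambda>a\<in>A. label_edges E a) ` graphs_with_labels A V F \<subseteq> PiE A F"
      by (auto simp: graphs_with_labels_def)
    show "dec ` PiE A F \<subseteq> graphs_with_labels A V F"
    proof (rule image_subsetI)
      fix g assume g: "g \<in> PiE A F"
      have "g a \<in> F a" if "a \<in> A" for a using g that by auto
      moreover from this have "dec g \<subseteq> V \<times> A \<times> V" using F by (fastforce simp: dec_def)
      ultimately show "dec g \<in> graphs_with_labels A V F"
        by (simp add: graphs_with_labels_def lab)
    qed
  qed
  then show ?thesis by (simp add: bij_betw_same_card card_PiE[OF assms(1)])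
qed

lemma label_edges_partial_injection:
  assumes "E \<subseteq> V \<times> A \<times> V" "folded E"
  shows "label_edges E a \<in> partial_injections V V"
  by (rule partial_injectionsI)
    (use assms(1) foldedD[OF assms(2)] in \<open>auto simp: label_edges_def\<close>)

lemma folded_iff_labels:
  assumes "E \<subseteq> V \<times> A \<times> V"
  shows "folded E \<longleftrightarrow> (\<forall>a\<in>A. label_edges E a \<in> partial_injections V V)"
proof
  assume *: "\<forall>a\<in>A. label_edges E a \<in> partial_injections V V"
  have a: "a \<in> A" if "(u, a, v) \<in> E" for u a v using assms that by auto
  show "folded E"
    unfolding folded_def
  proof (intro conjI allI impI)
    fix u a v v' assume e: "(u, a, v) \<in> E \<and> (u, a, v') \<in> E"
    then have "label_edges E a \<in> partial_injections V V" using * a by blast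
    then show "v = v'" by (rule partial_injectionsD(2)) (use e in \<open>auto simp: label_edges_def\<close>)
  next
    fix u u' a v assume e: "(u, a, v) \<in> E \<and> (u', a, v) \<in> E"
    then have "label_edges E a \<in> partial_injections V V" using * a by blast
    then show "u = u'" by (rule partial_injectionsD(3)) (use e in \<open>auto simp: label_edges_def\<close>)
  qed
qed (use label_edges_partial_injection[OF assms] in blast)

lemma partial_injections_subset: "partial_injections X Y \<subseteq> Pow (X \<times> Y)"
  by (auto simp: partial_injections_def)

lemma card_folded_graphs:
  assumes "finite A"
  shows "card (graphs_with_labels A {..<n} (\<lambda>_. partial_injections {..<n} {..<n})) = num_pinj n n ^ card A"
  by (subst card_graphs_with_labels[OF assms partial_injections_subset])
    (simp add: card_partial_injections)

text \<open>A total partial injection of a finite set is a permutation.\<close>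

lemma card_complete_graphs_le:
  assumes "finite A"
  shows "card {E \<in> admissible_edges A n. \<forall>u<n. \<forall>a\<in>A. \<exists>v. (u, a, v) \<in> E} \<le> fact n ^ card A"
proof -
  define F where "F = (\<lambda>\<phi>. {(u, \<phi> u) | u. u < n}) ` {\<phi>. \<phi> permutes {..<n}}"
  have finF: "finite F" by (simp add: F_def finite_permutations)
  have F_sub: "F \<subseteq> Pow ({..<n} \<times> {..<n})"
    using permutes_in_image by (fastforce simp: F_def)
  have "{E \<in> admissible_edges A n. \<forall>u<n. \<forall>a\<in>A. \<exists>v. (u, a, v) \<in> E} \<subseteq> graphs_with_labels A {..<n} (\<lambda>_. F)"
  proof (intro subsetI)
    fix E assume "E \<in> {E \<in> admissible_edges A n. \<forall>u<n. \<forall>a\<in>A. \<exists>v. (u, a, v) \<in> E}"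
    then have E: "E \<in> admissible_edges A n" and total: "\<And>u a. u < n \<Longrightarrow> a \<in> A \<Longrightarrow> \<exists>v. (u, a, v) \<in> E"
      by auto
    interpret pointed_graph A "{..<n}" E 0 by (rule pointed_graph_admissible_edges[OF assms E])
    have "label_edges E a \<in> F" if a: "a \<in> A" for a
    proof -
      define \<phi> where "\<phi> u = (if u < n then SOME v. (u, a, v) \<in> E else u)" for u
      have \<phi>: "(u, a, \<phi> u) \<in> E" if "u < n" for u
        using someI_ex[OF total[OF that a]] that by (simp add: \<phi>_def)
      have maps: "\<phi> u < n" if "u < n" for u using \<phi>[OF that] edges by auto
      have "inj_on \<phi> {..<n}"
        by (rule inj_onI) (metis \<phi> foldedD(2)[OF fold] lessThan_iff)
      moreover from this have "\<phi> ` {..<n} = {..<n}"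
        using maps by (intro endo_inj_surj) auto
      ultimately have "bij_betw \<phi> {..<n} {..<n}" by (simp add: bij_betw_def)
      then have "\<phi> permutes {..<n}" by (rule bij_imp_permutes) (simp add: \<phi>_def)
      moreover have "label_edges E a = {(u, \<phi> u) | u. u < n}"
      proof (intro equalityI subsetI)
        fix e assume "e \<in> label_edges E a"
        then obtain u v where e: "e = (u, v)" "(u, a, v) \<in> E" by (auto simp: label_edges_def)
        then have "u < n" using edges by auto
        then have "v = \<phi> u" using foldedD(1)[OF fold e(2)] \<phi> by blast
        then show "e \<in> {(u, \<phi> u) | u. u < n}" using e \<open>u < n\<close> by simp
      qed (use \<phi> in \<open>auto simp: label_edges_def\<close>)
      ultimately show ?thesis by (simp add: F_def)
    qed
    then show "E \<in> graphs_with_labels A {..<n} (\<lambda>_. F)"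
      using edges by (simp add: graphs_with_labels_def)
  qed
  moreover have "finite (graphs_with_labels A {..<n} (\<lambda>_. F))"
    by (rule finite_graphs_with_labels[OF assms finite_lessThan])
  ultimately have "card {E \<in> admissible_edges A n. \<forall>u<n. \<forall>a\<in>A. \<exists>v. (u, a, v) \<in> E} \<le>
      card (graphs_with_labels A {..<n} (\<lambda>_. F))"
    by (intro card_mono)
  also have "\<dots> = card F ^ card A"
    using F_sub by (subst card_graphs_with_labels[OF assms]) auto
  also have "card F \<le> fact n"
  proof -
    have "card F \<le> card {\<phi>. \<phi> permutes {..<n}}"
      unfolding F_def by (rule card_image_le) (simp add: finite_permutations)
    also have "\<dots> = fact n" by (rule card_permutations) simp_all
    finally show ?thesis .
  qed
  finally show ?thesis by (simp add: power_mono)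
qed

text \<open>A partial injection preserving a set and its complement is determined by its two restrictions.\<close>

lemma card_block_partial_injections:
  assumes "finite V" "S \<subseteq> V"
  shows "card {R \<in> partial_injections V V. R \<subseteq> S \<times> S \<union> (V - S) \<times> (V - S)} \<le>
    num_pinj (card S) (card S) * num_pinj (card V - card S) (card V - card S)"
    (is "card ?F \<le> _")
proof -
  let ?G = "partial_injections S S \<times> partial_injections (V - S) (V - S)"
  let ?f = "\<lambda>R. (R \<inter> S \<times> S, R \<inter> (V - S) \<times> (V - S))"
  have fin: "finite S" "finite (V - S)" using assms finite_subset by auto
  have "inj_on ?f ?F" by (rule inj_onI) blast
  moreover have "?f ` ?F \<subseteq> ?G"
  proof (rule image_subsetI)
    fix R assume "R \<in> ?F"
    then have R: "R \<in> partial_injections V V" by simp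
    have "R \<inter> S \<times> S \<in> partial_injections S S"
      by (rule partial_injectionsI) (use partial_injectionsD(2,3)[OF R] in auto)
    moreover have "R \<inter> (V - S) \<times> (V - S) \<in> partial_injections (V - S) (V - S)"
      by (rule partial_injectionsI) (use partial_injectionsD(2,3)[OF R] in auto)
    ultimately show "?f R \<in> ?G" by simp
  qed
  moreover have "finite ?G" using fin by (simp add: finite_partial_injections)
  ultimately have "card ?F \<le> card ?G" by (rule card_inj_on_le)
  also have "card ?G = num_pinj (card S) (card S) * num_pinj (card V - card S) (card V - card S)"
    using fin assms by (simp add: card_cartesian_product card_partial_injections card_Diff_subset)
  finally show ?thesis .
qed

definition split_graphs :: "'a set \<Rightarrow> nat \<Rightarrow> nat set \<Rightarrow> (nat \<times> 'a \<times> nat) set set" where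
  "split_graphs A n S = graphs_with_labels A {..<n}
    (\<lambda>_. {R \<in> partial_injections {..<n} {..<n}. R \<subseteq> S \<times> S \<union> ({..<n} - S) \<times> ({..<n} - S)})"

lemma card_split_graphs_le:
  assumes "finite A" "S \<subseteq> {..<n}"
  shows "card (split_graphs A n S) \<le>
    (num_pinj (card S) (card S) * num_pinj (n - card S) (n - card S)) ^ card A"
proof -
  have "card (split_graphs A n S) =
      card {R \<in> partial_injections {..<n} {..<n}. R \<subseteq> S \<times> S \<union> ({..<n} - S) \<times> ({..<n} - S)} ^ card A"
    unfolding split_graphs_def
    by (subst card_graphs_with_labels[OF assms(1)]) (auto simp: partial_injections_def)
  also have "\<dots> \<le> (num_pinj (card S) (card S) * num_pinj (n - card S) (n - card S)) ^ card A"
    using card_block_partial_injections[OF finite_lessThan assms(2)] by (intro power_mono) simp_all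
  finally show ?thesis .
qed

text \<open>The block S is a connected component or its complement, whichever is smaller.\<close>

lemma disconnected_split:
  assumes E: "E \<subseteq> {..<n} \<times> A \<times> {..<n}" "folded E" and disc: "\<not> graph_connected ({..<n}, E)"
  shows "\<exists>k\<in>{1..n div 2}. \<exists>S\<in>{S. S \<subseteq> {..<n} \<and> card S = k}. E \<in> split_graphs A n S"
proof -
  obtain u v where uv: "u < n" "v < n" "(u, v) \<notin> (adjacency E)\<^sup>*"
    using disc by (auto simp: graph_connected_def)
  define C where "C = {x. x < n \<and> (u, x) \<in> (adjacency E)\<^sup>*}"
  have closed: "x \<in> C \<longleftrightarrow> y \<in> C" if "(x, a, y) \<in> E" for x a y
  proof -
    have "x < n" "y < n" using E(1) that by auto
    moreover have "(x, y) \<in> adjacency E" "(y, x) \<in> adjacency E" using that by (auto simp: adjacency_def)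
    ultimately show ?thesis by (auto simp: C_def intro: rtrancl_into_rtrancl)
  qed
  have split: "E \<in> split_graphs A n S" if S: "S = C \<or> S = {..<n} - C" for S
  proof -
    have "label_edges E a \<subseteq> S \<times> S \<union> ({..<n} - S) \<times> ({..<n} - S)" for a
    proof
      fix e assume "e \<in> label_edges E a"
      then obtain x y where e: "e = (x, y)" "(x, a, y) \<in> E" by (auto simp: label_edges_def)
      then have "x < n" "y < n" using E(1) by auto
      then show "e \<in> S \<times> S \<union> ({..<n} - S) \<times> ({..<n} - S)" using closed[OF e(2)] S e(1) by auto
    qed
    then show ?thesis
      using E(1) label_edges_partial_injection[OF E] by (simp add: split_graphs_def graphs_with_labels_def)
  qed
  have C: "C \<subseteq> {..<n}" "u \<in> C" "v \<notin> C" using uv by (auto simp: C_def)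
  have finC: "finite C" using C(1) finite_subset by blast
  have "card C \<ge> 1" using C(2) finC by (simp add: Suc_le_eq card_gt_0_iff) blast
  moreover have "C \<subset> {..<n}" using C uv by blast
  then have "card C < n" using psubset_card_mono[of "{..<n}" C] by simp
  moreover have "card ({..<n} - C) = n - card C" using C(1) finC by (simp add: card_Diff_subset)
  ultimately have "card C \<in> {1..n div 2} \<or> card ({..<n} - C) \<in> {1..n div 2}" by auto
  then obtain S where "S = C \<or> S = {..<n} - C" "card S \<in> {1..n div 2}" by blast
  moreover from this have "S \<subseteq> {..<n}" using C(1) by blast
  ultimately show ?thesis using split by blast
qed

lemma card_disconnected_le:
  assumes "finite A"
  shows "card {E. E \<subseteq> {..<n} \<times> A \<times> {..<n} \<and> folded E \<and> \<not> graph_connected ({..<n}, E)} \<le>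
    (\<Sum>k = 1..n div 2. (n choose k) * (num_pinj k k * num_pinj (n - k) (n - k)) ^ card A)"
    (is "card ?D \<le> _")
proof -
  let ?\<S> = "\<lambda>k. {S. S \<subseteq> {..<n} \<and> card S = k}"
  have fin: "finite (split_graphs A n S)" for S
    unfolding split_graphs_def by (rule finite_graphs_with_labels[OF assms finite_lessThan])
  have fin\<S>: "finite (?\<S> k)" for k by simp
  have "?D \<subseteq> (\<Union>k\<in>{1..n div 2}. \<Union>S\<in>?\<S> k. split_graphs A n S)"
  proof (rule subsetI)
    fix E assume "E \<in> ?D"
    then have "E \<subseteq> {..<n} \<times> A \<times> {..<n}" "folded E" "\<not> graph_connected ({..<n}, E)" by simp_all
    then show "E \<in> (\<Union>k\<in>{1..n div 2}. \<Union>S\<in>?\<S> k. split_graphs A n S)"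
      unfolding UN_iff by (rule disconnected_split)
  qed
  then have "card ?D \<le> card (\<Union>k\<in>{1..n div 2}. \<Union>S\<in>?\<S> k. split_graphs A n S)"
    by (intro card_mono) (use fin in auto)
  also have "\<dots> \<le> (\<Sum>k = 1..n div 2. card (\<Union>S\<in>?\<S> k. split_graphs A n S))"
    by (rule card_UN_le) simp
  also have "\<dots> \<le> (\<Sum>k = 1..n div 2. \<Sum>S\<in>?\<S> k. card (split_graphs A n S))"
    by (intro sum_mono card_UN_le fin\<S>)
  also have "\<dots> \<le> (\<Sum>k = 1..n div 2. \<Sum>S\<in>?\<S> k. (num_pinj k k * num_pinj (n - k) (n - k)) ^ card A)"
    by (intro sum_mono) (use card_split_graphs_le[OF assms] in auto)
  also have "\<dots> = (\<Sum>k = 1..n div 2. (n choose k) * (num_pinj k k * num_pinj (n - k) (n - k)) ^ card A)"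
    using n_subsets[of "{..<n}"] by simp
  finally show ?thesis .
qed

text \<open>At a leaf at most one of the 2 |A| possible letters can be read. Choosing it, the partial injection of its
  label is undefined at the leaf on one side, and those of the other labels on both sides.\<close>

definition leaf_graphs :: "'a set \<Rightarrow> nat \<Rightarrow> nat \<Rightarrow> 'a letter \<Rightarrow> (nat \<times> 'a \<times> nat) set set" where
  "leaf_graphs A n w l = graphs_with_labels A {..<n}
    (\<lambda>a. partial_injections (if l = (a, True) then {..<n} else {..<n} - {w})
      (if l = (a, False) then {..<n} else {..<n} - {w}))"

lemma card_leaf_graphs:
  assumes "finite A" "w < n" "l \<in> A \<times> UNIV"
  shows "card (leaf_graphs A n w l) =
    num_pinj (n - 1) n * num_pinj (n - 1) (n - 1) ^ (card A - 1)"
proof -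
  let ?F = "\<lambda>a. partial_injections (if l = (a, True) then {..<n} else {..<n} - {w})
      (if l = (a, False) then {..<n} else {..<n} - {w})"
  have l: "fst l \<in> A" using assms(3) by auto
  have "card (leaf_graphs A n w l) = (\<Prod>a\<in>A. card (?F a))"
    unfolding leaf_graphs_def
    by (rule card_graphs_with_labels[OF assms(1)]) (auto simp: partial_injections_def)
  also have "\<dots> = card (?F (fst l)) * (\<Prod>a\<in>A - {fst l}. card (?F a))"
    by (rule prod.remove[OF assms(1) l])
  also have "(\<Prod>a\<in>A - {fst l}. card (?F a)) = (\<Prod>a\<in>A - {fst l}. num_pinj (n - 1) (n - 1))"
  proof (rule prod.cong[OF refl])
    fix a assume "a \<in> A - {fst l}"
    then have "l \<noteq> (a, True)" "l \<noteq> (a, False)" by auto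
    then show "card (?F a) = num_pinj (n - 1) (n - 1)"
      using assms(2) by (simp add: card_partial_injections)
  qed
  also have "\<dots> = num_pinj (n - 1) (n - 1) ^ (card A - 1)"
    using assms(1) l by simp
  also have "card (?F (fst l)) = num_pinj (n - 1) n"
  proof (cases "snd l")
    case True
    then have "l = (fst l, True)" by (simp add: prod_eq_iff)
    then have "?F (fst l) = partial_injections {..<n} ({..<n} - {w})" using True by (auto simp: prod_eq_iff)
    then show ?thesis using assms(2) by (simp add: card_partial_injections num_pinj_commute[of n])
  next
    case False
    then have "?F (fst l) = partial_injections ({..<n} - {w}) {..<n}" by (auto simp: prod_eq_iff)
    then show ?thesis using assms(2) by (simp add: card_partial_injections)
  qed
  finally show ?thesis .
qed

lemma not_trim_leaf_graphs:
  assumes fin: "finite A" "A \<noteq> {}" and E: "E \<subseteq> {..<n} \<times> A \<times> {..<n}" "folded E"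
    and "\<not> trim ({..<n}, E) b"
  shows "\<exists>w\<in>{..<n}. \<exists>l\<in>A \<times> UNIV. E \<in> leaf_graphs A n w l"
proof -
  have finE: "finite E" by (rule finite_subset[OF E(1)]) (use fin in simp)
  obtain w where w: "w < n" "card (letters_at E w) \<le> 1"
    using assms(5) occurrences_eq_card_letters[OF E(2) finE] by (auto simp: trim_def leaf_def)
  have "letters_at E w \<subseteq> A \<times> UNIV"
    using E(1) by (auto simp: letters_at_def step_def split: if_splits)
  moreover have "letters_at E w = {} \<or> (\<exists>l. letters_at E w = {l})"
    using w(2) finite_letters_at[OF finE, of w] card_1_singletonE[of "letters_at E w"]
    by (metis One_nat_def card_0_eq le_Suc_eq le_zero_eq)
  ultimately obtain l where l: "l \<in> A \<times> UNIV" "letters_at E w \<subseteq> {l}"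
    using fin(2) by (metis SigmaI UNIV_I empty_subsetI ex_in_conv insert_subset order_refl)
  have out: "l = (a, True)" if "(w, a, v) \<in> E" for a v
    using l(2) that by (force simp: letters_at_def step_def)
  have inc: "l = (a, False)" if "(v, a, w) \<in> E" for a v
    using l(2) that by (force simp: letters_at_def step_def)
  have "label_edges E a \<in> partial_injections (if l = (a, True) then {..<n} else {..<n} - {w})
      (if l = (a, False) then {..<n} else {..<n} - {w})" for a
  proof (rule partial_injectionsI)
    show "label_edges E a \<subseteq> (if l = (a, True) then {..<n} else {..<n} - {w}) \<times>
        (if l = (a, False) then {..<n} else {..<n} - {w})"
      using E(1) out[of a] inc[of _ a] by (auto simp: label_edges_def)
  qed (use foldedD[OF E(2)] in \<open>auto simp: label_edges_def\<close>)
  then have "E \<in> leaf_graphs A n w l" using E(1) by (simp add: leaf_graphs_def graphs_with_labels_def)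
  then show ?thesis using w(1) l(1) by blast
qed

lemma card_not_trim_le:
  assumes fin: "finite A" "A \<noteq> {}"
  shows "card {E. E \<subseteq> {..<n} \<times> A \<times> {..<n} \<and> folded E \<and> \<not> trim ({..<n}, E) b} \<le>
    n * (2 * card A) * (num_pinj (n - 1) n * num_pinj (n - 1) (n - 1) ^ (card A - 1))"
    (is "card ?D \<le> _")
proof -
  let ?L = "A \<times> (UNIV :: bool set)"
  have finL: "finite (leaf_graphs A n w l)" for w l
    unfolding leaf_graphs_def by (rule finite_graphs_with_labels[OF fin(1) finite_lessThan])
  have "?D \<subseteq> (\<Union>w\<in>{..<n}. \<Union>l\<in>?L. leaf_graphs A n w l)"
  proof (rule subsetI)
    fix E assume "E \<in> ?D"
    then have "E \<subseteq> {..<n} \<times> A \<times> {..<n}" "folded E" "\<not> trim ({..<n}, E) b" by simp_all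
    then show "E \<in> (\<Union>w\<in>{..<n}. \<Union>l\<in>?L. leaf_graphs A n w l)"
      unfolding UN_iff by (rule not_trim_leaf_graphs[OF fin])
  qed
  then have "card ?D \<le> card (\<Union>w\<in>{..<n}. \<Union>l\<in>?L. leaf_graphs A n w l)"
    by (intro card_mono) (use finL fin in auto)
  also have "\<dots> \<le> (\<Sum>w<n. card (\<Union>l\<in>?L. leaf_graphs A n w l))"
    by (rule card_UN_le) simp
  also have "\<dots> \<le> (\<Sum>w<n. \<Sum>l\<in>?L. card (leaf_graphs A n w l))"
    using fin by (intro sum_mono card_UN_le) simp
  also have "\<dots> = (\<Sum>w<n. \<Sum>l\<in>?L. num_pinj (n - 1) n * num_pinj (n - 1) (n - 1) ^ (card A - 1))"
    by (intro sum.cong refl card_leaf_graphs fin) auto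
  also have "\<dots> = n * (2 * card A) * (num_pinj (n - 1) n * num_pinj (n - 1) (n - 1) ^ (card A - 1))"
    by (simp add: card_cartesian_product card_UNIV_bool)
  finally show ?thesis .
qed

lemma card_admissible_edges_ge:
  assumes fin: "finite A" "A \<noteq> {}" and n: "n \<ge> 1"
  shows "num_pinj n n ^ card A \<le> card (admissible_edges A n) +
    (\<Sum>k = 1..n div 2. (n choose k) * (num_pinj k k * num_pinj (n - k) (n - k)) ^ card A) +
    n * (2 * card A) * (num_pinj (n - 1) n * num_pinj (n - 1) (n - 1) ^ (card A - 1))"
proof -
  let ?V = "{..<n}"
  let ?D = "{E. E \<subseteq> ?V \<times> A \<times> ?V \<and> folded E \<and> \<not> graph_connected (?V, E)}"
  let ?T = "{E. E \<subseteq> ?V \<times> A \<times> ?V \<and> folded E \<and> \<not> trim (?V, E) 0}"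
  have finX: "finite {E. E \<subseteq> ?V \<times> A \<times> ?V \<and> P E}" for P
  proof (rule finite_subset)
    show "{E. E \<subseteq> ?V \<times> A \<times> ?V \<and> P E} \<subseteq> Pow (?V \<times> A \<times> ?V)" by (rule subsetI) simp
  qed (use fin in simp)
  have adm: "E \<in> admissible_edges A n \<longleftrightarrow>
      E \<subseteq> ?V \<times> A \<times> ?V \<and> folded E \<and> graph_connected (?V, E) \<and> trim (?V, E) 0" for E
    using n by (auto simp: admissible_edges_def admissible_def A_graph_def folded_def)
  have "num_pinj n n ^ card A = card {E. E \<subseteq> ?V \<times> A \<times> ?V \<and> folded E}"
  proof -
    have "{E. E \<subseteq> ?V \<times> A \<times> ?V \<and> folded E} = graphs_with_labels A ?V (\<lambda>_. partial_injections ?V ?V)"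
      unfolding graphs_with_labels_def using folded_iff_labels[of _ ?V A] by blast
    then show ?thesis using card_folded_graphs[OF fin(1)] by simp
  qed
  also have "\<dots> \<le> card (admissible_edges A n \<union> ?D \<union> ?T)"
  proof (rule card_mono)
    show "finite (admissible_edges A n \<union> ?D \<union> ?T)"
      using finX finite_admissible_edges[OF fin(1)] by simp
    show "{E. E \<subseteq> ?V \<times> A \<times> ?V \<and> folded E} \<subseteq> admissible_edges A n \<union> ?D \<union> ?T"
      using adm by auto
  qed
  also have "\<dots> \<le> card (admissible_edges A n) + card ?D + card ?T"
    using card_Un_le[of "admissible_edges A n \<union> ?D" ?T] card_Un_le[of "admissible_edges A n" ?D] by linarith
  also have "\<dots> \<le> card (admissible_edges A n) +
    (\<Sum>k = 1..n div 2. (n choose k) * (num_pinj k k * num_pinj (n - k) (n - k)) ^ card A) +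
    n * (2 * card A) * (num_pinj (n - 1) n * num_pinj (n - 1) (n - 1) ^ (card A - 1))"
    by (intro add_mono card_disconnected_le card_not_trim_le fin order_refl)
  finally show ?thesis .
qed

section \<open>Growth of the number of partial injections\<close>

text \<open>The inverse of the probability that a random partial injection of n points is a permutation.\<close>

definition pinj_ratio :: "nat \<Rightarrow> real" where
  "pinj_ratio n = num_pinj n n / fact n"

lemma pinj_ratio_eq: "pinj_ratio n = (\<Sum>j\<le>n. (n choose j) / fact j)"
proof -
  have "pinj_ratio n = (\<Sum>k\<le>n. real ((n choose k) * (n choose k) * fact k) / fact n)"
    by (simp add: pinj_ratio_def num_pinj_def sum_divide_distrib)
  also have "\<dots> = (\<Sum>k\<le>n. (n choose (n - k)) / fact (n - k))"
  proof (rule sum.cong[OF refl])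
    fix k assume "k \<in> {..n}"
    then have k: "k \<le> n" by simp
    have *: "real (n choose k) * fact k / fact n = 1 / fact (n - k)"
      by (simp add: binomial_fact[OF k] field_simps)
    have "real ((n choose k) * (n choose k) * fact k) / fact n =
        real (n choose k) * (real (n choose k) * fact k / fact n)" by simp
    also have "\<dots> = (n choose (n - k)) / fact (n - k)"
      unfolding * by (simp flip: binomial_symmetric[OF k])
    finally show "real ((n choose k) * (n choose k) * fact k) / fact n =
        (n choose (n - k)) / fact (n - k)" .
  qed
  also have "\<dots> = (\<Sum>j\<le>n. (n choose j) / fact j)"
    by (rule sum.reindex_bij_witness[of _ "\<lambda>j. n - j" "\<lambda>j. n - j"]) auto
  finally show ?thesis .
qed

lemma pinj_ratio_pos: "pinj_ratio n > 0"
  using num_pinj_pos[of n] by (simp add: pinj_ratio_def)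

lemma pinj_ratio_mono: "m \<le> n \<Longrightarrow> pinj_ratio m \<le> pinj_ratio n"
proof (rule lift_Suc_mono_le[of pinj_ratio])
  fix n
  have "real (Suc n * num_pinj n n) \<le> real (num_pinj (Suc n) (Suc n))"
    using num_pinj_remove_both[of "Suc n"] by (simp only: of_nat_le_iff diff_Suc_1)
  then have "real (Suc n * num_pinj n n) / fact (Suc n) \<le> pinj_ratio (Suc n)"
    unfolding pinj_ratio_def by (rule divide_right_mono) simp
  moreover have "real (Suc n * num_pinj n n) / fact (Suc n) = pinj_ratio n"
    unfolding pinj_ratio_def fact_Suc of_nat_mult by (rule mult_divide_mult_cancel_left) simp
  ultimately show "pinj_ratio n \<le> pinj_ratio (Suc n)" by simp
qed

lemma exp_sums: "(\<lambda>j. x ^ j / fact j) sums exp (x :: real)"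
  using exp_converges[of x] by (simp add: field_simps)

text \<open>As (n choose j) is at most n^j/j!, the summands are bounded by the squares of the terms of the exponential series of
  sqrt n, and a sum of squares of nonnegative numbers is at most the square of their sum.\<close>

lemma pinj_ratio_le: "pinj_ratio n \<le> exp (2 * sqrt n)"
proof -
  define p where "p j = sqrt n ^ j / fact j" for j
  have p0: "p j \<ge> 0" for j by (simp add: p_def)
  have "pinj_ratio n \<le> (\<Sum>j\<le>n. p j * p j)"
    unfolding pinj_ratio_eq
  proof (rule sum_mono)
    fix j
    have "real (n choose j) * fact j \<le> real n ^ j"
      using binomial_fact_pow[of n j] by (metis of_nat_fact of_nat_le_iff of_nat_mult of_nat_power)
    moreover have "sqrt n ^ j * sqrt n ^ j = real n ^ j"
      by (simp flip: power_mult_distrib)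
    ultimately show "real (n choose j) / fact j \<le> p j * p j"
      by (simp add: p_def field_simps)
  qed
  also have "\<dots> \<le> (\<Sum>j\<le>n. p j * exp (sqrt n))"
  proof (intro sum_mono mult_left_mono p0)
    fix j
    have "sum p {j} \<le> suminf p"
      using exp_sums[of "sqrt n"] p0 unfolding p_def by (intro sum_le_suminf) (auto simp: sums_iff)
    then show "p j \<le> exp (sqrt n)"
      using exp_sums[of "sqrt n"] by (simp add: p_def[abs_def] sums_iff)
  qed
  also have "\<dots> = (\<Sum>j\<le>n. p j) * exp (sqrt n)" by (simp add: sum_distrib_right)
  also have "\<dots> \<le> exp (sqrt n) * exp (sqrt n)"
  proof (rule mult_right_mono)
    have "sum p {..n} \<le> suminf p"
      using exp_sums[of "sqrt n"] p0 unfolding p_def by (intro sum_le_suminf) (auto simp: sums_iff)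
    then show "sum p {..n} \<le> exp (sqrt n)"
      using exp_sums[of "sqrt n"] by (simp add: p_def[abs_def] sums_iff)
  qed simp
  also have "\<dots> = exp (2 * sqrt n)" by (simp flip: exp_add)
  finally show ?thesis .
qed

text \<open>Chebyshev's inequality for the Poisson distribution of parameter x, whose variance is x, in
  unnormalised form.\<close>

lemma exp_sum_window:
  fixes x :: real
  assumes "x > 0" "finite W" and W: "\<And>j. \<bar>real j - x\<bar> < 2 * sqrt x \<Longrightarrow> j \<in> W"
  shows "3 / 4 * exp x \<le> (\<Sum>j\<in>W. x ^ j / fact j)"
proof -
  define p where "p j = x ^ j / fact j" for j
  have p0: "p j \<ge> 0" for j using assms(1) by (simp add: p_def)
  have s0: "p sums exp x" using exp_sums[of x] by (simp add: p_def[abs_def])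
  have pS: "real (Suc j) * p (Suc j) = x * p j" for j
    unfolding p_def fact_Suc by (simp del: of_nat_Suc)
  have s1: "(\<lambda>j. real j * p j) sums (x * exp x)"
  proof -
    have "(\<lambda>j. real (Suc j) * p (Suc j)) sums (x * exp x)" unfolding pS by (rule sums_mult[OF s0])
    then show ?thesis using sums_Suc[of "\<lambda>j. real j * p j"] by simp
  qed
  have s2: "(\<lambda>j. real j * (real j - 1) * p j) sums (x * (x * exp x))"
  proof -
    have *: "real (Suc j) * (real (Suc j) - 1) * p (Suc j) = x * (real j * p j)" for j
    proof -
      have "real (Suc j) * (real (Suc j) - 1) * p (Suc j) = real j * (real (Suc j) * p (Suc j))"
        by simp
      then show ?thesis unfolding pS by simp
    qed
    have "(\<lambda>j. real (Suc j) * (real (Suc j) - 1) * p (Suc j)) sums (x * (x * exp x))"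
      unfolding * by (rule sums_mult[OF s1])
    then show ?thesis using sums_Suc[of "\<lambda>j. real j * (real j - 1) * p j"] by simp
  qed
  have "(\<lambda>j. real j * (real j - 1) * p j + (1 - 2 * x) * (real j * p j) + x\<^sup>2 * p j) sums
      (x * (x * exp x) + (1 - 2 * x) * (x * exp x) + x\<^sup>2 * exp x)"
    by (intro sums_add sums_mult s0 s1 s2)
  moreover have "real j * (real j - 1) * p j + (1 - 2 * x) * (real j * p j) + x\<^sup>2 * p j =
      (real j - x)\<^sup>2 * p j" for j
    by (simp add: power2_eq_square algebra_simps)
  moreover have "x * (x * exp x) + (1 - 2 * x) * (x * exp x) + x\<^sup>2 * exp x = x * exp x"
    by (simp add: power2_eq_square algebra_simps)
  ultimately have var: "(\<lambda>j. (real j - x)\<^sup>2 * p j) sums (x * exp x)" by simp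
  have sW: "(\<lambda>j. if j \<in> W then p j else 0) sums sum p W" by (rule sums_If_finite_set[OF assms(2)])
  have "exp x \<le> 1 / (4 * x) * (x * exp x) + sum p W"
  proof (rule sums_le[OF _ s0 sums_add[OF sums_mult[OF var] sW]])
    fix j
    show "p j \<le> 1 / (4 * x) * ((real j - x)\<^sup>2 * p j) + (if j \<in> W then p j else 0)"
    proof (cases "j \<in> W")
      case True
      then show ?thesis using p0[of j] assms(1) by simp
    next
      case False
      then have "2 * sqrt x \<le> \<bar>real j - x\<bar>" using W[of j] by linarith
      then have "(2 * sqrt x)\<^sup>2 \<le> \<bar>real j - x\<bar>\<^sup>2" using assms(1) by (intro power_mono) auto
      then have "4 * x \<le> (real j - x)\<^sup>2" using assms(1) by (simp add: power_mult_distrib)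
      then have "4 * x * p j \<le> (real j - x)\<^sup>2 * p j" using p0 by (rule mult_right_mono)
      then show ?thesis using False assms(1) by (simp add: field_simps)
    qed
  qed
  then show ?thesis using assms(1) by (simp add: p_def)
qed

lemma binomial_times_fact_ge:
  assumes "j \<le> m" "m \<le> n"
  shows "(n - m) ^ j \<le> (n choose j) * fact j"
  using assms(1)
proof (induction j)
  case (Suc j)
  have "Suc j * (n choose Suc j) = (n - j) * (n choose j)"
    by (metis binomial_absorb_comp binomial_absorption)
  then have "(Suc j * (n choose Suc j)) * fact j = ((n - j) * (n choose j)) * fact j" by simp
  then have "(n choose Suc j) * fact (Suc j) = ((n choose j) * fact j) * (n - j)"
    by (simp only: fact_Suc of_nat_id ac_simps)
  moreover have "(n - m) ^ j * (n - m) \<le> ((n choose j) * fact j) * (n - j)"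
    using Suc by (intro mult_mono) auto
  ultimately show ?case by (simp add: mult.commute)
qed simp

lemma exp_le_one_minus:
  fixes t :: real
  assumes "0 \<le> t" "t \<le> 1 / 2"
  shows "exp (- 2 * t) \<le> 1 - t"
proof -
  have "1 \<le> (1 + 2 * t) * (1 - t)"
    using mult_left_mono[OF assms(2,1)] by (simp add: algebra_simps)
  also have "\<dots> \<le> exp (2 * t) * (1 - t)"
    using assms by (intro mult_right_mono exp_ge_add_one_self) auto
  finally show ?thesis by (simp add: exp_minus field_simps)
qed

text \<open>Around its maximum, at j near x = sqrt n, the summand of \<open>pinj_ratio\<close> is, up to a constant, the square of the
  Poisson weight x^j/j!, as there (n choose j) differs from n^j/j! by a bounded factor.
  The window has about sqrt x elements and carries most of the sum exp x of the weights, so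
  the Cauchy-Schwarz inequality bounds the sum of the squares from below.\<close>

lemma pinj_ratio_ge:
  assumes n: "n \<ge> 36"
  shows "exp (- 18) * 9 / 80 * exp (2 * sqrt n) / sqrt (sqrt n) \<le> pinj_ratio n"
proof -
  define x where "x = sqrt (real n)"
  have x6: "x \<ge> 6" using n real_sqrt_le_mono[of 36 "real n"] by (simp add: x_def)
  have xx: "x * x = n" by (simp add: x_def)
  define s where "s = sqrt x"
  have s: "s \<ge> 1" "s * s = x" "s \<le> x"
  proof -
    show "s \<ge> 1" "s * s = x" using x6 by (simp_all add: s_def)
    then show "s \<le> x" using mult_left_mono[of 1 s s] by simp
  qed
  define a b where "a = nat \<lceil>x - 2 * s\<rceil>" and "b = nat \<lfloor>x + 2 * s\<rfloor>"
  define W where "W = {a..b}"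
  define p where "p j = x ^ j / fact j" for j
  have p0: "p j \<ge> 0" for j using x6 by (simp add: p_def)
  have mass: "3 / 4 * exp x \<le> sum p W"
    unfolding p_def
  proof (rule exp_sum_window)
    show "j \<in> W" if "\<bar>real j - x\<bar> < 2 * sqrt x" for j
    proof -
      have "x - 2 * s \<le> real j" "real j \<le> x + 2 * s" using that by (auto simp: s_def)
      then show ?thesis unfolding W_def a_def b_def by (auto simp: le_nat_iff nat_le_iff ceiling_le_iff le_floor_iff)
    qed
  qed (use x6 in \<open>auto simp: W_def\<close>)
  have b: "real b \<le> x + 2 * s" and a: "x - 2 * s \<le> real a"
    using x6 s by (simp_all add: a_def b_def real_nat_ceiling_ge)
  have cardW: "real (card W) \<le> 5 * s"
  proof (cases "a \<le> b")
    case True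
    then have "real (card W) = real b + 1 - real a" by (simp add: W_def of_nat_diff)
    then show ?thesis using a b s(1) by linarith
  qed (use s in \<open>simp add: W_def\<close>)
  have W3: "real j \<le> 3 * x" if "j \<in> W" for j
    using that b s(3) by (simp add: W_def)
  have "3 * x \<le> x * x" using x6 by (intro mult_right_mono) auto
  then have Wn: "j \<le> n" if "j \<in> W" for j
    using W3[OF that] xx by linarith
  have binom: "exp (- 18) * (p j)\<^sup>2 \<le> (n choose j) / fact j" if "j \<in> W" for j
  proof -
    have j: "real j \<le> 3 * x" "j \<le> n" using W3 Wn that by auto
    have jx: "real j / n \<le> 3 / x" using j(1) x6 by (simp add: xx[symmetric] field_simps)
    have "exp (- 18) \<le> exp (- 2 * (3 / x)) ^ j"
    proof -
      have "real j * (6 / x) \<le> 18" using j(1) x6 by (simp add: field_simps)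
      then show ?thesis by (simp flip: exp_of_nat_mult)
    qed
    also have "\<dots> \<le> (1 - real j / n) ^ j"
    proof (rule power_mono)
      have "exp (- 2 * (3 / x)) \<le> 1 - 3 / x" by (rule exp_le_one_minus) (use x6 in \<open>auto simp: field_simps\<close>)
      then show "exp (- 2 * (3 / x)) \<le> 1 - real j / n" using jx by linarith
    qed simp
    finally have "exp (- 18) * real n ^ j \<le> (1 - real j / n) ^ j * real n ^ j"
      by (intro mult_right_mono) auto
    also have "\<dots> = real (n - j) ^ j"
      using n j(2) by (simp add: of_nat_diff field_simps flip: power_mult_distrib)
    also have "\<dots> \<le> real (n choose j) * fact j"
      using binomial_times_fact_ge[OF order_refl j(2)]
      by (metis of_nat_fact of_nat_le_iff of_nat_mult of_nat_power)
    finally have "exp (- 18) * real n ^ j \<le> real (n choose j) * fact j" .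
    then have "exp (- 18) * real n ^ j / (fact j * fact j) \<le> real (n choose j) * fact j / (fact j * fact j)"
      by (rule divide_right_mono) simp
    moreover have "(p j)\<^sup>2 = real n ^ j / (fact j * fact j)"
      unfolding p_def xx[symmetric] by (simp add: power2_eq_square power_mult_distrib)
    ultimately show ?thesis by simp
  qed
  have "exp (- 18) * 9 / 80 * exp (2 * x) / s = exp (- 18) * ((3 / 4 * exp x)\<^sup>2 / (5 * s))"
    using exp_add[of x x] by (simp add: power2_eq_square)
  also have "\<dots> \<le> exp (- 18) * (\<Sum>j\<in>W. (p j)\<^sup>2)"
  proof (rule mult_left_mono)
    have "(3 / 4 * exp x)\<^sup>2 \<le> (sum p W)\<^sup>2" by (rule power_mono[OF mass]) simp
    also have "\<dots> \<le> (\<Sum>j\<in>W. (p j)\<^sup>2) * card W" by (rule sum_squared_le_sum_of_squares)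
    also have "\<dots> \<le> (\<Sum>j\<in>W. (p j)\<^sup>2) * (5 * s)"
      by (rule mult_left_mono[OF cardW]) (simp add: sum_nonneg)
    finally show "(3 / 4 * exp x)\<^sup>2 / (5 * s) \<le> (\<Sum>j\<in>W. (p j)\<^sup>2)"
      using s(1) by (simp add: divide_le_eq)
  qed simp
  also have "\<dots> \<le> (\<Sum>j\<in>W. (n choose j) / fact j)"
    unfolding sum_distrib_left by (rule sum_mono) (rule binom)
  also have "\<dots> \<le> (\<Sum>j\<le>n. (n choose j) / fact j)"
    by (rule sum_mono2) (use Wn in auto)
  also have "\<dots> = pinj_ratio n" by (simp add: pinj_ratio_eq)
  finally show ?thesis by (simp add: x_def s_def)
qed

lemma binomial_ge_linear_times_power:
  assumes "1 \<le> k" "2 * k \<le> n"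
  shows "real n * 2 ^ (k - 1) / k \<le> real (n choose k)"
proof -
  have "(2::real) ^ (k - 1) \<le> (real (n - 1) / real (k - 1)) ^ (k - 1)"
  proof (cases "k = 1")
    case False
    then have "2 * real (k - 1) \<le> real (n - 1)" "real (k - 1) > 0" using assms by linarith+
    then show ?thesis by (intro power_mono) (auto simp: field_simps)
  qed simp
  also have "\<dots> \<le> real ((n - 1) choose (k - 1))"
    by (rule binomial_ge_n_over_k_pow_k) (use assms in linarith)
  finally have "real n * 2 ^ (k - 1) \<le> real n * real ((n - 1) choose (k - 1))"
    by (rule mult_left_mono) simp
  also have "\<dots> = real k * real (n choose k)"
  proof -
    have "k * (n choose k) = n * ((n - 1) choose (k - 1))"
      using binomial_absorption[of "k - 1" n] assms(1) by simp
    then show ?thesis by (metis of_nat_mult)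
  qed
  finally show ?thesis using assms(1) by (simp add: field_simps)
qed

text \<open>Since I(n) = n! a(n) with a nondecreasing and a(k) at most exp (2 sqrt k), the quotient
  I(k) I(n - k) / I(n) is at most exp (2 sqrt k) / (n choose k). After the choice of the block, of the r
  binomial coefficients in the denominator r - 1 survive, and as r \<ge> 2 each of these can be charged
  with a factor exp (4 sqrt k). The quotients exp (4 sqrt k) / (n choose k) are at most 1 / n times the
  terms q(k) of a series with geometric decay.\<close>

lemma sum_split_blocks_le:
  assumes r: "r \<ge> 2"
  obtains K where "\<And>n. n \<ge> 1 \<Longrightarrow>
    (\<Sum>k = 1..n div 2. real ((n choose k) * (num_pinj k k * num_pinj (n - k) (n - k)) ^ r)) \<le>
      K / n * real (num_pinj n n ^ r)"
proof -
  define s where "s = r - 1"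
  have s: "s \<ge> 1" "r = Suc s" using r by (auto simp: s_def)
  define q where "q k = real k * exp (4 * sqrt (real k)) / 2 ^ (k - 1)" for k :: nat
  \<comment> \<open>Writing 1 / 2 = (2 / 3) (3 / 4), the factor (2 / 3)^k absorbs the subexponential
    growth and (3 / 4)^k remains.\<close>
  define l where "l = ln (3 / 2 :: real)"
  have l: "l > 0" by (simp add: l_def)
  define h where "h k = real k * exp (4 * sqrt (real k)) * exp (- (l * real k))" for k :: nat
  have "h \<longlonglongrightarrow> 0" unfolding h_def using l by real_asymp
  then have "Bseq h" by (intro convergent_imp_Bseq) (auto simp: convergent_def)
  then obtain M where M: "M > 0" "\<And>k. h k \<le> M"
    by (auto simp: Bseq_def abs_le_iff)
  define B where "B = 2 * M"
  have q0: "q k \<ge> 0" for k by (simp add: q_def)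
  have B0: "B \<ge> 0" using M by (simp add: B_def)
  have B: "q k \<le> B * (3 / 4) ^ k" if "k \<ge> 1" for k
  proof -
    have "exp (- (l * real k)) = (2 / 3) ^ k"
      by (simp add: l_def exp_minus mult.commute[of "ln _"] exp_of_nat_mult flip: power_inverse)
    then have "h k * (3 / 4) ^ k = real k * exp (4 * sqrt (real k)) * ((2 / 3) ^ k * (3 / 4) ^ k)"
      by (simp add: h_def)
    also have "(2 / 3 :: real) ^ k * (3 / 4) ^ k = (1 / 2) ^ k"
      by (simp flip: power_mult_distrib)
    finally have "q k = 2 * h k * (3 / 4) ^ k"
      using that by (cases k) (simp_all add: q_def power_divide field_simps)
    also have "\<dots> \<le> B * (3 / 4) ^ k"
      unfolding B_def using M(2)[of k] by (intro mult_right_mono) auto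
    finally show ?thesis .
  qed
  have main: "(\<Sum>k = 1..n div 2. real ((n choose k) * (num_pinj k k * num_pinj (n - k) (n - k)) ^ r)) \<le>
      (B ^ s * 4) / n * real (num_pinj n n ^ r)" if n: "n \<ge> 1" for n
  proof -
    have bound: "real ((n choose k) * (num_pinj k k * num_pinj (n - k) (n - k)) ^ r) \<le>
        (B ^ s / n * (3 / 4) ^ k) * real (num_pinj n n ^ r)" if k: "k \<in> {1..n div 2}" for k
    proof -
      have k': "k \<ge> 1" "2 * k \<le> n" "k \<le> n" using k by auto
      define c where "c = real (n choose k)"
      have c0: "c > 0" using k' by (simp add: c_def zero_less_binomial)
      define e where "e = exp (2 * sqrt (real k))"
      have c_ge: "exp (4 * sqrt k) / c \<le> q k / n"
      proof -
        have "exp (4 * sqrt k) * (real n * 2 ^ (k - 1) / k) \<le> exp (4 * sqrt k) * c"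
          unfolding c_def using binomial_ge_linear_times_power[OF k'(1,2)] by (intro mult_left_mono) auto
        then show ?thesis using k'(1) n c0 by (simp add: q_def field_simps)
      qed
      have "real (num_pinj k k) * real (num_pinj (n - k) (n - k)) =
          fact k * fact (n - k) * (pinj_ratio k * pinj_ratio (n - k))"
        by (simp add: pinj_ratio_def)
      also have "\<dots> \<le> fact k * fact (n - k) * (e * pinj_ratio n)"
        unfolding e_def
        by (intro mult_left_mono mult_mono pinj_ratio_le pinj_ratio_mono less_imp_le[OF pinj_ratio_pos]) auto
      also have "\<dots> = e / c * real (num_pinj n n)"
        by (simp add: c_def binomial_fact[OF k'(3)] pinj_ratio_def field_simps)
      finally have "(real (num_pinj k k) * real (num_pinj (n - k) (n - k))) ^ r \<le>
          (e / c * real (num_pinj n n)) ^ r"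
        by (rule power_mono) simp
      then have "c * (real (num_pinj k k) * real (num_pinj (n - k) (n - k))) ^ r \<le>
          c * (e / c * real (num_pinj n n)) ^ r"
        using c0 by (intro mult_left_mono) auto
      also have "\<dots> = e ^ r / c ^ s * real (num_pinj n n) ^ r"
        using c0 by (simp add: power_mult_distrib power_divide s(2))
      also have "e ^ r / c ^ s \<le> (exp (4 * sqrt k) / c) ^ s"
      proof -
        have "e ^ r \<le> e ^ (2 * s)" by (rule power_increasing) (use s in \<open>auto simp: e_def\<close>)
        also have "\<dots> = exp (4 * sqrt k) ^ s" by (simp add: e_def power_mult flip: exp_double)
        finally show ?thesis using c0 by (simp add: power_divide divide_right_mono)
      qed
      also have "(exp (4 * sqrt k) / c) ^ s \<le> (q k / n) ^ s"
        by (rule power_mono[OF c_ge]) (use c0 in simp)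
      also have "(q k / n) ^ s \<le> (B * (3 / 4) ^ k) ^ s / n"
      proof -
        have "(q k) ^ s \<le> (B * (3 / 4) ^ k) ^ s" by (rule power_mono[OF B[OF k'(1)] q0])
        moreover have "real n ^ 1 \<le> real n ^ s" using n s(1) by (intro power_increasing) auto
        ultimately have "(q k) ^ s / real n ^ s \<le> (B * (3 / 4) ^ k) ^ s / real n"
          using n q0 by (intro frac_le) (auto intro: order_trans[OF zero_le_power[OF q0]])
        then show ?thesis by (simp add: power_divide)
      qed
      also have "(B * (3 / 4) ^ k) ^ s \<le> B ^ s * (3 / 4) ^ k"
      proof -
        have "(3 / 4 :: real) ^ (k * s) \<le> (3 / 4) ^ k"
          using s(1) by (intro power_decreasing) auto
        then show ?thesis using B0 by (simp add: power_mult_distrib mult_left_mono flip: power_mult)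
      qed
      finally show ?thesis by (simp add: c_def mult_right_mono divide_right_mono)
    qed
    have geo: "(\<Sum>k = 1..n div 2. (3 / 4 :: real) ^ k) \<le> 4"
    proof -
      have "(\<Sum>k = 1..n div 2. (3 / 4 :: real) ^ k) \<le> (\<Sum>k. (3 / 4) ^ k)"
        by (rule sum_le_suminf) auto
      then show ?thesis by (simp add: suminf_geometric)
    qed
    have "(\<Sum>k = 1..n div 2. real ((n choose k) * (num_pinj k k * num_pinj (n - k) (n - k)) ^ r)) \<le>
        (\<Sum>k = 1..n div 2. (B ^ s / n * (3 / 4) ^ k) * real (num_pinj n n ^ r))"
      by (rule sum_mono) (rule bound)
    also have "\<dots> = (B ^ s / n) * (\<Sum>k = 1..n div 2. (3 / 4) ^ k) * real (num_pinj n n ^ r)"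
      by (simp only: sum_distrib_left sum_distrib_right)
    also have "\<dots> \<le> (B ^ s / n) * 4 * real (num_pinj n n ^ r)"
      using B0 by (intro mult_right_mono mult_left_mono geo) auto
    finally show ?thesis by simp
  qed
  show ?thesis by (rule that) (rule main)
qed

section \<open>The probability of finite index\<close>

text \<open>Of the leaf factors, one is bounded by 1 / sqrt n and one by 1 / n, which already outweighs the n possible
  positions of the leaf; both error terms are therefore o(1).\<close>

lemma eventually_half_admissible:
  fixes A :: "'a set"
  assumes fin: "finite A" and r: "card A \<ge> 2"
  shows "eventually (\<lambda>n. real (num_pinj n n) ^ card A \<le> 2 * real (card (admissible_edges A n))) sequentially"
proof -
  define r where "r = card A"
  have r2: "r \<ge> 2" and ne: "A \<noteq> {}" using r by (auto simp: r_def)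
  obtain K where K: "\<And>n. n \<ge> 1 \<Longrightarrow>
    (\<Sum>k = 1..n div 2. real ((n choose k) * (num_pinj k k * num_pinj (n - k) (n - k)) ^ r)) \<le>
      K / n * real (num_pinj n n ^ r)"
    by (rule sum_split_blocks_le[OF r2]) blast
  have "(\<lambda>n. K / real n + 2 * real r / sqrt (real n)) \<longlonglongrightarrow> 0" by real_asymp
  then have "eventually (\<lambda>n. K / real n + 2 * real r / sqrt (real n) < 1 / 2) sequentially"
    by (rule order_tendstoD) simp
  then show ?thesis
    using eventually_ge_at_top[of 1]
  proof eventually_elim
    case (elim n)
    define x y z where "x = real (num_pinj n n)" and "y = real (num_pinj (n - 1) n)"
      and "z = real (num_pinj (n - 1) (n - 1))"
    have pos: "y \<ge> 0" "z \<ge> 0" "x \<ge> 0" by (simp_all add: x_def y_def z_def)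
    have y: "sqrt n * y \<le> x" using num_pinj_remove_one[OF elim(2)] by (simp add: x_def y_def)
    have z: "real n * z \<le> x"
      using num_pinj_remove_both[of n] unfolding x_def z_def by (metis of_nat_le_iff of_nat_mult)
    have "z \<le> real n * z" using mult_right_mono[of 1 "real n" z] elim(2) pos by simp
    then have z': "z \<le> x" using z by simp
    obtain t where t: "r = Suc (Suc t)" using r2 by (metis Suc_le_D numeral_2_eq_2 Suc_le_mono)
    have leaf: "real n * (y * z ^ (r - 1)) \<le> x ^ r / sqrt n"
    proof -
      have "sqrt n * (real n * (y * z ^ (r - 1))) = (sqrt n * y) * ((real n * z) * z ^ t)"
        by (simp add: t)
      also have "\<dots> \<le> x * (x * x ^ t)"
        using y z z' pos by (intro mult_mono power_mono) auto
      finally show ?thesis using elim(2) by (simp add: t field_simps)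
    qed
    have "real (num_pinj n n ^ r) \<le> real (card (admissible_edges A n) +
        (\<Sum>k = 1..n div 2. (n choose k) * (num_pinj k k * num_pinj (n - k) (n - k)) ^ r) +
        n * (2 * r) * (num_pinj (n - 1) n * num_pinj (n - 1) (n - 1) ^ (r - 1)))"
      using card_admissible_edges_ge[OF fin ne elim(2)] unfolding r_def of_nat_le_iff .
    also have "\<dots> = real (card (admissible_edges A n)) +
        (\<Sum>k = 1..n div 2. real ((n choose k) * (num_pinj k k * num_pinj (n - k) (n - k)) ^ r)) +
        2 * real r * (real n * (y * z ^ (r - 1)))"
      by (simp add: y_def z_def)
    also have "\<dots> \<le> real (card (admissible_edges A n)) + K / n * x ^ r + 2 * real r * (x ^ r / sqrt n)"
      using K[OF elim(2)] leaf by (intro add_mono mult_left_mono) (auto simp: x_def)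
    also have "\<dots> = real (card (admissible_edges A n)) + (K / n + 2 * real r / sqrt n) * x ^ r"
      by (simp add: algebra_simps)
    also have "\<dots> \<le> real (card (admissible_edges A n)) + 1 / 2 * x ^ r"
      using elim(1) pos by (intro add_left_mono mult_right_mono) auto
    finally show ?case by (simp add: x_def r_def)
  qed
qed

lemma prob_finite_index_le:
  fixes A :: "'a set"
  assumes fin: "finite A" and r: "card A \<ge> 2"
    and half: "real (num_pinj n n) ^ card A \<le> 2 * real (card (admissible_edges A n))"
  shows "prob_finite_index A n \<le> 2 / pinj_ratio n ^ card A"
proof -
  have pos: "0 < real (num_pinj n n) ^ card A" using num_pinj_pos by simp
  have "real (card (admissible_edges A n)) > 0" using pos half by linarith
  then have ne: "admissible_edges A n \<noteq> {}" by auto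
  have "{E \<in> admissible_edges A n. finite_index (free_group A) (loops E 0)} \<subseteq>
      {E \<in> admissible_edges A n. \<forall>u<n. \<forall>a\<in>A. \<exists>v. (u, a, v) \<in> E}"
  proof (intro subsetI)
    fix E assume "E \<in> {E \<in> admissible_edges A n. finite_index (free_group A) (loops E 0)}"
    then have E: "E \<in> admissible_edges A n" "finite_index (free_group A) (loops E 0)" by simp_all
    then have "admissible A ({..<n}, E) 0" by (simp add: admissible_edges_def)
    then have "\<exists>v. (u, a, v) \<in> E" if "u < n" "a \<in> A" for u a
      using complete_if_finite_index[OF fin r _ E(2)] that by simp
    then show "E \<in> {E \<in> admissible_edges A n. \<forall>u<n. \<forall>a\<in>A. \<exists>v. (u, a, v) \<in> E}"
      using E(1) by simp
  qed
  then have "card {E \<in> admissible_edges A n. finite_index (free_group A) (loops E 0)} \<le>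
      card {E \<in> admissible_edges A n. \<forall>u<n. \<forall>a\<in>A. \<exists>v. (u, a, v) \<in> E}"
    using finite_admissible_edges[OF fin] by (intro card_mono) simp_all
  also have "\<dots> \<le> fact n ^ card A" by (rule card_complete_graphs_le[OF fin])
  finally have "real (card {E \<in> admissible_edges A n. finite_index (free_group A) (loops E 0)}) \<le>
      real (fact n ^ card A)"
    by (simp only: of_nat_le_iff)
  then have "real (card {E \<in> admissible_edges A n. finite_index (free_group A) (loops E 0)}) \<le>
      fact n ^ card A" by simp
  then have "prob_finite_index A n \<le> fact n ^ card A / (real (num_pinj n n) ^ card A / 2)"
    unfolding prob_finite_index_eq[OF fin ne] using half pos by (intro frac_le) auto
  also have "\<dots> = 2 / pinj_ratio n ^ card A"
    by (simp add: pinj_ratio_def power_divide)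
  finally show ?thesis .
qed

theorem proposition5p1:
  fixes A :: "'a set" and r :: nat
  assumes "finite A" and "r = card A" and "r \<ge> 2"
  shows "(\<lambda>n. prob_finite_index A n) \<in>
           O(\<lambda>n. real n powr (real r / 4) * exp (- 2 * real r * sqrt (real n)))
       \<and> (\<forall>k :: real. k \<ge> 1 \<longrightarrow> (\<lambda>n. prob_finite_index A n) \<in> o(\<lambda>n. real n powr (- k)))"
proof -
  let ?g = "\<lambda>n. real n powr (real r / 4) * exp (- 2 * real r * sqrt (real n))"
  define c :: real where "c = exp (- 18) * 9 / 80"
  have c: "c > 0" by (simp add: c_def)
  have r: "card A \<ge> 2" using assms by simp
  have "eventually (\<lambda>n. norm (prob_finite_index A n) \<le> 2 / c ^ r * norm (?g n)) sequentially"
    using eventually_half_admissible[OF assms(1) r] eventually_ge_at_top[of 36]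
  proof eventually_elim
    case (elim n)
    have n: "real n > 0" using elim(2) by simp
    have "(c * exp (2 * sqrt n) / sqrt (sqrt n)) ^ r \<le> pinj_ratio n ^ r"
      using pinj_ratio_ge[OF elim(2)] c n unfolding c_def by (intro power_mono) auto
    moreover have "0 < (c * exp (2 * sqrt n) / sqrt (sqrt n)) ^ r" using c n by simp
    ultimately have "2 / pinj_ratio n ^ r \<le> 2 / (c * exp (2 * sqrt n) / sqrt (sqrt n)) ^ r"
      by (intro divide_left_mono mult_pos_pos zero_less_power pinj_ratio_pos) (use c n in simp_all)
    also have "\<dots> = 2 / c ^ r * (sqrt (sqrt n) ^ r * (1 / exp (2 * sqrt n) ^ r))"
      by (simp add: power_divide power_mult_distrib)
    also have "sqrt (sqrt n) ^ r = real n powr (real r / 4)"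
      using n by (simp add: powr_half_sqrt[symmetric] powr_powr powr_power)
    also have "1 / exp (2 * sqrt n) ^ r = exp (- 2 * real r * sqrt n)"
      by (simp add: exp_of_nat_mult[symmetric] exp_minus field_simps)
    finally have "prob_finite_index A n \<le> 2 / c ^ r * ?g n"
      using prob_finite_index_le[OF assms(1) r elim(1)] assms(2) by simp
    moreover have "prob_finite_index A n \<ge> 0" by (simp add: prob_finite_index_def)
    ultimately show ?case by simp
  qed
  then have O: "prob_finite_index A \<in> O(?g)" by (rule bigoI)
  have "?g \<in> o(\<lambda>n. real n powr (- k))" for k
  proof -
    have "real r > 0" using assms(3) by simp
    then show ?thesis by real_asymp
  qed
  then have "prob_finite_index A \<in> o(\<lambda>n. real n powr (- k))" for k
    using O landau_o.big_small_trans by blast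
  with O show ?thesis by blast
qed

end
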